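(* A non-trivial $m$-ovoid of $\mathcal Q^-(7,3)$ can exist only for $m\in\{4,5,8,9\}$. Moreover, every $4$-ovoid of $\mathcal Q^-(7,3)$ is the union of the lines of a $1$-system of $\mathcal Q^-(7,3)$.
   Context: $\mathcal Q^-(7,q)$ is the elliptic quadric of rank $3$ in $\mathrm{PG}(7,q)$ (points singular for a non-degenerate quadratic form of Witt index $3$ on $\mathbb F_q^{8}$); its generators are the planes contained in it. An $m$-ovoid is a set of points of the quadric meeting every generator in exactly $m$ points; it is trivial if it is empty ($m=0$) or the whole point set ($m=q^2+q+1$). A $1$-system of $\mathcal Q^-(7,q)$ is a set of $q^4+1$ pairwise disjoint lines $\ell_1,\dots,\ell_{q^4+1}$ contained in the quadric such that every plane of the quadric containing some $\ell_i$ is disjoint from $\bigcup_{j\ne i}\ell_j$. *)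

theory Defs
  imports "HOL-Analysis.Cartesian_Space" "HOL-Library.Numeral_Type"
begin

definition polar :: "('f::field ^ 'n \<Rightarrow> 'f) \<Rightarrow> 'f ^ 'n \<Rightarrow> 'f ^ 'n \<Rightarrow> 'f" where
  "polar Q x y = Q (x + y) - Q x - Q y"

definition quadratic_form :: "('f::field ^ 'n \<Rightarrow> 'f) \<Rightarrow> bool" where
  "quadratic_form Q \<longleftrightarrow>
     (\<forall>c x. Q (c *s x) = c\<^sup>2 * Q x) \<and>
     (\<forall>y. Vector_Spaces.linear (*s) (*) (\<lambda>x. polar Q x y)) \<and>
     (\<forall>x. Vector_Spaces.linear (*s) (*) (\<lambda>y. polar Q x y))"

text \<open>Stated so as to be the usual notion in every characteristic; away from characteristic 2
  the conjunct \<open>Q x = 0\<close> is redundant, as \<open>polar Q x x = 2 * Q x\<close>.\<close>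

definition nondegenerate :: "('f::field ^ 'n \<Rightarrow> 'f) \<Rightarrow> bool" where
  "nondegenerate Q \<longleftrightarrow> (\<forall>x. Q x = 0 \<and> (\<forall>y. polar Q x y = 0) \<longrightarrow> x = 0)"

definition totally_singular :: "('f::field ^ 'n \<Rightarrow> 'f) \<Rightarrow> ('f ^ 'n) set \<Rightarrow> bool" where
  "totally_singular Q U \<longleftrightarrow> vec.subspace U \<and> (\<forall>x\<in>U. Q x = 0)"

definition witt_index :: "('f::field ^ 'n \<Rightarrow> 'f) \<Rightarrow> nat" where
  "witt_index Q = Max (vec.dim ` {U. totally_singular Q U})"

text \<open>Projective subspaces are represented by linear subspaces, so a point, line or plane of the
  quadric is a totally singular subspace of linear dimension 1, 2 or 3.\<close>

definition quadric_points :: "('f::field ^ 'n \<Rightarrow> 'f) \<Rightarrow> ('f ^ 'n) set set" where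
  "quadric_points Q = {P. totally_singular Q P \<and> vec.dim P = 1}"

definition quadric_lines :: "('f::field ^ 'n \<Rightarrow> 'f) \<Rightarrow> ('f ^ 'n) set set" where
  "quadric_lines Q = {l. totally_singular Q l \<and> vec.dim l = 2}"

definition quadric_planes :: "('f::field ^ 'n \<Rightarrow> 'f) \<Rightarrow> ('f ^ 'n) set set" where
  "quadric_planes Q = {\<pi>. totally_singular Q \<pi> \<and> vec.dim \<pi> = 3}"

definition points_on :: "('f::field ^ 'n) set \<Rightarrow> ('f ^ 'n) set set" where
  "points_on U = {P. vec.subspace P \<and> vec.dim P = 1 \<and> P \<subseteq> U}"

text \<open>The form \<open>Q\<close> defines an elliptic quadric \<open>Q\<^sup>-(7,q)\<close>, where \<open>q = CARD('f)\<close>.\<close>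

definition elliptic_form_7 :: "('f::{field,finite} ^ 8 \<Rightarrow> 'f) \<Rightarrow> bool" where
  "elliptic_form_7 Q \<longleftrightarrow> quadratic_form Q \<and> nondegenerate Q \<and> witt_index Q = 3"

definition m_ovoid :: "('f::{field,finite} ^ 8 \<Rightarrow> 'f) \<Rightarrow> nat \<Rightarrow> ('f ^ 8) set set \<Rightarrow> bool" where
  "m_ovoid Q m S \<longleftrightarrow>
     S \<subseteq> quadric_points Q \<and> (\<forall>\<pi>\<in>quadric_planes Q. card (S \<inter> points_on \<pi>) = m)"

definition trivial_ovoid :: "('f::{field,finite} ^ 8 \<Rightarrow> 'f) \<Rightarrow> ('f ^ 8) set set \<Rightarrow> bool" where
  "trivial_ovoid Q S \<longleftrightarrow> S = {} \<or> S = quadric_points Q"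

definition one_system :: "('f::{field,finite} ^ 8 \<Rightarrow> 'f) \<Rightarrow> ('f ^ 8) set set \<Rightarrow> bool" where
  "one_system Q L \<longleftrightarrow>
     L \<subseteq> quadric_lines Q \<and> card L = CARD('f) ^ 4 + 1 \<and>
     (\<forall>l\<in>L. \<forall>l'\<in>L. l \<noteq> l' \<longrightarrow> points_on l \<inter> points_on l' = {}) \<and>
     (\<forall>l\<in>L. \<forall>\<pi>\<in>quadric_planes Q. l \<subseteq> \<pi> \<longrightarrow>
        points_on \<pi> \<inter> (\<Union>l'\<in>L - {l}. points_on l') = {})"

end

(* Fix a singular point p. The lines of the quadric on p are the points of a Q^-(5,3), and the
   weight w(l) = number of points of the ovoid O on l other than p makes it a weighted k-ovoid,
   where k = m - 1 if p is in O and k = m otherwise. In Q^-(5,3) a certain variance vanishes, so that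
   all hyperplanes carry the expected weight. Double counting then gives, besides the sum of w, a
   quadratic identity between the sum of w^2 over the lines coplanar with a given line and the sum
   T(p) of w^2 over all lines on p. Summed over the four points p of a line l of the quadric, the
   coplanar contributions are determined by the number a of points of O on l, and the result is
   affine in a. As the incidence matrix of points and lines of a plane is invertible, T(p) is known
   for every p.

   The integers w thus have prescribed first and second moments, also around each line. Since
   w(w - 1) is even, m(m - 1) is divisible by 4 as soon as some p is not in O; m = 1 and m = 12 are
   excluded by the moments. For m = 4 and p in O no w equals 2 and exactly one w equals 3, so p lies
   on exactly one line contained in O. *)

theory Submission
  imports Defs
begin

text \<open>Why the variance vanishes: let \<open>H v\<close> be the sum of \<open>w\<close> over
  the hyperplane perpendicular to \<open>v\<close>. The first two moments of \<open>H\<close> over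
  all vectors depend only on the sums of \<open>w\<close> and of its square, because the number of
  \<open>v\<close> perpendicular to one or two given vectors is known. \<open>H\<close> itself is
  known at 0 and, by the ovoid condition, at singular vectors. These values already exhaust the
  second moment about \<open>20 * k\<close>, so nothing is left for the nonsingular vectors.

  The moments over all lines on p would not give the congruence: for p outside O the sum of w(w - 1)
  over these lines is \<open>4 * m^2 + 2 * m\<close>, which is even for every m. Only the sum over
  the lines coplanar with a fixed one restricts m.

  As q = 3, a point is a pair \<open>v\<close>, \<open>- v\<close>. All sums therefore run over
  vectors and carry a factor 2, and dimensions are tracked as sizes, that is, as powers of
  3.\<close>

lemma four_dvd_sum_even:
  fixes \<phi> :: "'a::ab_group_add \<Rightarrow> int"
  assumes "finite Z" "\<And>z. z \<in> Z \<Longrightarrow> - z \<in> Z \<and> z \<noteq> - z \<and> \<phi> (- z) = \<phi> z \<and> 2 dvd \<phi> z"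
  shows "4 dvd sum \<phi> Z"
  using assms
proof (induction Z rule: finite_psubset_induct)
  case (psubset Z)
  show ?case
  proof (cases "Z = {}")
    case False
    then obtain z where z: "z \<in> Z" by blast
    let ?Z = "Z - {z, - z}"
    have "4 dvd sum \<phi> ?Z"
    proof (rule psubset.IH)
      show "?Z \<subset> Z" using z by blast
    next
      fix y assume "y \<in> ?Z"
      then show "- y \<in> ?Z \<and> y \<noteq> - y \<and> \<phi> (- y) = \<phi> y \<and> 2 dvd \<phi> y"
        using psubset.prems[of y] by auto
    qed
    moreover have "sum \<phi> Z = sum \<phi> ?Z + sum \<phi> {z, - z}"
      using psubset.hyps psubset.prems[OF z] z by (intro sum.subset_diff) auto
    moreover have "sum \<phi> {z, - z} = 2 * \<phi> z" using psubset.prems[OF z] by simp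
    moreover have "4 dvd 2 * \<phi> z" using psubset.prems[OF z] by (auto elim!: dvdE)
    ultimately show ?thesis by simp
  qed simp
qed

lemma span_singleton_eq:
  fixes P :: "('f::{field,finite} ^ 'n::finite) set"
  assumes "vec.subspace P" "vec.dim P = 1" "x \<in> P" "x \<noteq> 0"
  shows "vec.span {x} = P"
proof (rule vec.subspace_dim_equal)
  show "vec.span {x} \<subseteq> P" using assms by (simp add: vec.span_minimal)
  show "vec.dim P \<le> vec.dim (vec.span {x})" using assms by simp
qed (use assms in simp_all)

subsection \<open>Ternary quadratic forms\<close>

locale ternary_form =
  fixes Q :: "'f::{field,finite} ^ 'n::finite \<Rightarrow> 'f"
  assumes card_field: "CARD('f) = 3" and quadratic: "quadratic_form Q"
begin

section \<open>Arithmetic over the field of three elements and the polar form\<close>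

abbreviation B where "B \<equiv> polar Q"

lemma one_neq_minus_one: "(1::'f) \<noteq> -1"
  and UNIV_field: "(UNIV::'f set) = {0, 1, -1}"
proof -
  obtain x :: 'f where x: "x \<noteq> 0" "x \<noteq> 1"
  proof -
    have "\<not> (UNIV::'f set) \<subseteq> {0, 1}"
      using card_mono[of "{0, 1::'f}" UNIV] card_field by auto
    then show ?thesis using that by blast
  qed
  have U: "(UNIV::'f set) = {0, 1, x}"
    by (rule card_seteq[symmetric]) (use x card_field in auto)
  have "x + 1 \<in> {0, 1, x}" using U by blast
  then have "x = -1" using x by (auto simp: add_eq_0_iff2)
  show "(1::'f) \<noteq> -1" using x \<open>x = -1\<close> by metis
  show "(UNIV::'f set) = {0, 1, -1}" using U unfolding \<open>x = -1\<close> .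
qed

lemma field_cases: "(c::'f) = 0 \<or> c = 1 \<or> c = -1"
  using UNIV_field by (metis UNIV_I empty_iff insert_iff)

lemma one_plus_one: "(1::'f) + 1 = -1"
proof -
  have "(1::'f) + 1 \<noteq> 0" using one_neq_minus_one add_eq_0_iff by metis
  moreover have "(1::'f) + 1 \<noteq> 1" using add_cancel_right_right zero_neq_one by metis
  ultimately show ?thesis using field_cases by metis
qed

lemma sum_field: "(\<Sum>c\<in>(UNIV::'f set). g c) = g 0 + g 1 + g (-1)"
  using one_neq_minus_one by (simp add: UNIV_field add.assoc)

lemma double: "x + x = - (x::'f ^ 'm)" "c + c = - (c::'f)"
proof -
  have "x + x = (1 + 1) *s x" by (simp only: vec.scale_left_distrib vec.scale_one)
  then show "x + x = - x" unfolding one_plus_one by simp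
  have "c + c = (1 + 1) * c" by (simp only: distrib_right mult_1)
  then show "c + c = - c" unfolding one_plus_one by simp
qed

lemma vec_neq_minus: "x \<noteq> 0 \<Longrightarrow> x \<noteq> - x" for x :: "'f ^ 'm"
  using double(1)[of x] by (metis add_cancel_right_right)

lemma B_add: "B (x + y) z = B x z + B y z" "B z (x + y) = B z x + B z y"
  and B_scale: "B (c *s x) z = c * B x z" "B z (c *s x) = c * B z x"
proof -
  have l: "Vector_Spaces.linear (*s) (*) (\<lambda>x. B x z)" "Vector_Spaces.linear (*s) (*) (\<lambda>x. B z x)" for z
    using quadratic unfolding quadratic_form_def by auto
  show "B (x + y) z = B x z + B y z" "B z (x + y) = B z x + B z y"
    "B (c *s x) z = c * B x z" "B z (c *s x) = c * B z x"
    using l[of z] by (auto simp: Vector_Spaces.linear_iff)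
qed

lemma B_minus [simp]: "B (- x) z = - B x z" "B z (- x) = - B z x"
  using B_scale(1)[of "-1" x z] B_scale(2)[of z "-1" x] by simp_all

lemma B_diff: "B (x - y) z = B x z - B y z" "B z (x - y) = B z x - B z y"
  using B_add(1)[of x "- y" z] B_add(2)[of z x "- y"] by simp_all

lemma B_zero [simp]: "B 0 z = 0" "B z 0 = 0"
  using B_scale(1)[of 0 0 z] B_scale(2)[of z 0 0] by simp_all

lemma B_sym: "B x y = B y x"
  by (simp add: polar_def add.commute)

lemma Q_scale: "Q (c *s x) = c\<^sup>2 * Q x"
  using quadratic unfolding quadratic_form_def by auto

lemma Q_minus [simp]: "Q (- x) = Q x"
  using Q_scale[of "-1" x] by simp

lemma Q_zero [simp]: "Q 0 = 0"
  using Q_scale[of 0 0] by simp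

lemma Q_add: "Q (x + y) = Q x + Q y + B x y"
  by (simp add: polar_def)

lemma Q_diff: "Q (x - y) = Q x + Q y - B x y"
  using Q_add[of x "- y"] by simp

lemma B_self: "B x x = - Q x"
proof -
  have "Q (x + x) = Q x" by (simp add: double)
  then show ?thesis using double(2)[of "Q x"] by (simp add: polar_def)
qed

lemmas form_simps = B_add B_diff B_scale Q_add Q_diff Q_scale

section \<open>Singular vectors and the splitting off of hyperbolic planes\<close>

definition sing :: "('f ^ 'n) set \<Rightarrow> ('f ^ 'n) set" where
  "sing U = {x \<in> U. x \<noteq> 0 \<and> Q x = 0}"

text \<open>Only the polar form is tested: by \<open>B_self\<close>, a vector in its radical is
  automatically singular.\<close>

definition nondeg :: "('f ^ 'n) set \<Rightarrow> bool" where
  "nondeg U \<longleftrightarrow> (\<forall>x\<in>U. (\<forall>y\<in>U. B x y = 0) \<longrightarrow> x = 0)"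

definition hyp_pair :: "('f ^ 'n) set \<Rightarrow> 'f ^ 'n \<Rightarrow> 'f ^ 'n \<Rightarrow> bool" where
  "hyp_pair U e f \<longleftrightarrow> e \<in> U \<and> f \<in> U \<and> Q e = 0 \<and> Q f = 0 \<and> B e f = 1"

definition perp2 :: "('f ^ 'n) set \<Rightarrow> 'f ^ 'n \<Rightarrow> 'f ^ 'n \<Rightarrow> ('f ^ 'n) set" where
  "perp2 U e f = {z \<in> U. B e z = 0 \<and> B f z = 0}"

lemma subspace_perp2: "vec.subspace U \<Longrightarrow> vec.subspace (perp2 U e f)"
  unfolding vec.subspace_def perp2_def by (auto simp: form_simps)

lemma hyp_partner:
  assumes "vec.subspace U" "nondeg U" "e \<in> sing U"
  obtains f where "hyp_pair U e f"
proof -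
  obtain y where y: "y \<in> U" "B e y \<noteq> 0" using assms unfolding nondeg_def sing_def by blast
  define y' where "y' = inverse (B e y) *s y"
  have y': "y' \<in> U" "B e y' = 1"
    using y assms by (auto simp: y'_def vec.subspace_scale B_scale)
  have e: "e \<in> U" "Q e = 0" "B e e = 0" using assms(3) B_self[of e] by (auto simp: sing_def)
  have "B y' e = 1" using y'(2) B_sym[of y' e] by metis
  \<comment> \<open>As \<open>B y' e = 1\<close>, subtracting \<open>Q y' *s e\<close> makes
    \<open>y'\<close> singular; as \<open>B e e = 0\<close>, the pairing with \<open>e\<close> stays
    1.\<close>
  then have "hyp_pair U e (y' - Q y' *s e)"
    using assms(1) y' e unfolding hyp_pair_def
    by (simp add: form_simps vec.subspace_diff vec.subspace_scale)
  then show ?thesis using that by blast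
qed

lemma hyp_pairD:
  assumes "hyp_pair U e f"
  shows "e \<in> U" "f \<in> U" "Q e = 0" "Q f = 0" "B e f = 1" "B f e = 1" "B e e = 0" "B f f = 0"
  using assms B_self[of e] B_self[of f] B_sym[of f e] by (auto simp: hyp_pair_def)

lemma nondeg_perp2:
  assumes "vec.subspace U" "nondeg U" "hyp_pair U e f"
  shows "nondeg (perp2 U e f)"
  unfolding nondeg_def
proof (intro ballI impI)
  fix x assume x: "x \<in> perp2 U e f" "\<forall>y\<in>perp2 U e f. B x y = 0"
  have "B x y = 0" if "y \<in> U" for y
  proof -
    \<comment> \<open>This is the projection of \<open>y\<close> along \<open>e\<close> and
      \<open>f\<close>. Since \<open>x\<close> is perpendicular to \<open>e\<close>,
      \<open>f\<close> and all projections, it is perpendicular to all of \<open>U\<close>.\<close>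
    have "y - B f y *s e - B e y *s f \<in> perp2 U e f"
      using assms(1) that hyp_pairD[OF assms(3)] unfolding perp2_def
      by (simp add: form_simps vec.subspace_diff vec.subspace_scale)
    then have "B x (y - B f y *s e - B e y *s f) = 0" using x by blast
    moreover have "B x e = 0" "B x f = 0"
      using x(1) B_sym[of x e] B_sym[of x f] by (auto simp: perp2_def)
    ultimately show ?thesis by (simp add: form_simps)
  qed
  then show "x = 0" using x assms by (auto simp: nondeg_def perp2_def)
qed

lemma bij_hyp_split:
  assumes "vec.subspace U" "hyp_pair U e f"
  shows "bij_betw (\<lambda>(a, b, z). a *s e + b *s f + z) (UNIV \<times> UNIV \<times> perp2 U e f) U"
proof -
  let ?g = "\<lambda>y. (B f y, B e y, y - B f y *s e - B e y *s f)"
  note s = hyp_pairD[OF assms(2)]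
  show ?thesis
  proof (rule bij_betwI[where g = ?g], goal_cases)
    case 1
    show ?case using assms(1) s by (auto simp: perp2_def vec.subspace_add vec.subspace_scale)
  next
    case 2
    show ?case using assms(1) s unfolding perp2_def
      by (auto simp: form_simps vec.subspace_diff vec.subspace_scale)
  next
    case (3 x)
    obtain a b z where [simp]: "x = (a, b, z)" by (cases x)
    show ?case using s 3 by (auto simp: perp2_def form_simps)
  next
    case (4 y)
    then show ?case by (simp add: algebra_simps)
  qed
qed

lemma sum_hyp_split:
  assumes "vec.subspace U" "hyp_pair U e f"
  shows "sum g U = (\<Sum>a\<in>UNIV. \<Sum>b\<in>UNIV. \<Sum>z\<in>perp2 U e f. g (a *s e + b *s f + z))"
  unfolding sum.reindex_bij_betw[OF bij_hyp_split[OF assms], symmetric]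
  by (simp add: sum.cartesian_product split_def)

text \<open>In the coordinates \<open>a *s e + b *s f + z\<close> the form is
  \<open>a * b + Q z\<close>. For fixed \<open>z\<close> it vanishes for 5 pairs \<open>a\<close>,
  \<open>b\<close> if \<open>Q z = 0\<close> and for 2 pairs otherwise. The last summand 2 appears
  because \<open>sing\<close> omits the zero vector on both sides.\<close>

lemma hyp_split:
  assumes "vec.subspace U" "hyp_pair U e f"
  shows sum_perp_hyp: "(\<Sum>x | x \<in> U \<and> B e x = 0. g x) = (\<Sum>z\<in>perp2 U e f. \<Sum>a\<in>UNIV. g (z + a *s e))"
    and card_hyp: "card U = 9 * card (perp2 U e f)"
    and card_sing_hyp: "card (sing U) = 2 * card (perp2 U e f) + 3 * card (sing (perp2 U e f)) + 2"
proof -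
  note s = hyp_pairD[OF assms(2)]
  have "(\<Sum>x | x \<in> U \<and> B e x = 0. g x) = (\<Sum>x\<in>U. if B e x = 0 then g x else 0)"
    using sum.inter_filter[of U g "\<lambda>x. B e x = 0"] by simp
  also have "\<dots> = (\<Sum>a\<in>UNIV. \<Sum>z\<in>perp2 U e f. g (z + a *s e))"
  proof -
    have *: "B e (a *s e + b *s f + z) = b" if "z \<in> perp2 U e f" for a b z
      using s that by (auto simp: form_simps perp2_def)
    have "(\<Sum>x\<in>U. if B e x = 0 then g x else 0) =
        (\<Sum>a\<in>UNIV. \<Sum>b\<in>(UNIV::'f set). if b = 0 then \<Sum>z\<in>perp2 U e f. g (z + a *s e) else 0)"
      unfolding sum_hyp_split[OF assms] by (rule sum.cong[OF refl], rule sum.cong[OF refl]) (auto simp: * add.commute[of _ "_ *s e"] intro!: sum.cong)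
    then show ?thesis by simp
  qed
  finally show "(\<Sum>x | x \<in> U \<and> B e x = 0. g x) = (\<Sum>z\<in>perp2 U e f. \<Sum>a\<in>UNIV. g (z + a *s e))"
    by (subst sum.swap)
  show "card U = 9 * card (perp2 U e f)"
    using bij_betw_same_card[OF bij_hyp_split[OF assms]] card_field by (simp add: card_cartesian_product)
  have sing': "card {x \<in> W. Q x = 0} = Suc (card (sing W))" if "vec.subspace W" for W
  proof -
    have "{x \<in> W. Q x = 0} = insert 0 (sing W)" using vec.subspace_0[OF that] by (auto simp: sing_def)
    then show ?thesis by (simp add: sing_def)
  qed
  have "card {x \<in> U. Q x = 0} = (\<Sum>x\<in>U. if Q x = 0 then 1 else 0)"
    using sum.inter_filter[of U "\<lambda>_. 1::nat" "\<lambda>x. Q x = 0"] by simp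
  also have "\<dots> = (\<Sum>a\<in>UNIV. \<Sum>b\<in>UNIV. \<Sum>z\<in>perp2 U e f. if a * b + Q z = 0 then 1 else 0)"
  proof -
    have *: "Q (a *s e + b *s f + z) = a * b + Q z" if "z \<in> perp2 U e f" for a b z
      using s that by (auto simp: form_simps perp2_def)
    then show ?thesis unfolding sum_hyp_split[OF assms] by (simp add: * cong: sum.cong)
  qed
  also have "\<dots> = (\<Sum>z\<in>perp2 U e f. \<Sum>a\<in>UNIV. \<Sum>b\<in>UNIV. if a * b + Q z = 0 then 1 else 0)"
    by (simp add: sum.swap[of _ "perp2 U e f"])
  also have "\<dots> = (\<Sum>z\<in>perp2 U e f. 2 + 3 * (if Q z = 0 then 1 else 0))"
  proof (rule sum.cong[OF refl])
    fix z
    show "(\<Sum>a\<in>UNIV. \<Sum>b\<in>UNIV. if a * b + Q z = 0 then 1 else 0) = 2 + 3 * (if Q z = 0 then 1 else (0::nat))"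
      using field_cases[of "Q z"] one_neq_minus_one one_neq_minus_one[symmetric] one_plus_one
      by (auto simp: sum_field double(2))
  qed
  also have "\<dots> = 2 * card (perp2 U e f) + 3 * card {z \<in> perp2 U e f. Q z = 0}"
    using sum.inter_filter[of "perp2 U e f" "\<lambda>_. 1::nat" "\<lambda>x. Q x = 0"]
    by (simp only: sum.distrib sum_distrib_left[symmetric]) simp
  finally show "card (sing U) = 2 * card (perp2 U e f) + 3 * card (sing (perp2 U e f)) + 2"
    using sing'[OF assms(1)] sing'[OF subspace_perp2[OF assms(1), of e f]] by simp
qed

section \<open>Sizes of perpendicular subspaces\<close>

lemma card_kernel:
  assumes "vec.subspace U" "u \<in> U" "B x u \<noteq> 0"
  shows "card U = 3 * card {v \<in> U. B x v = 0}"
proof -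
  define u' where "u' = inverse (B x u) *s u"
  have u': "u' \<in> U" "B x u' = 1" using assms by (auto simp: u'_def B_scale vec.subspace_scale)
  have "bij_betw (\<lambda>(a, v). a *s u' + v) (UNIV \<times> {v \<in> U. B x v = 0}) U"
  proof (rule bij_betwI[where g = "\<lambda>v. (B x v, v - B x v *s u')"], goal_cases)
    case 1
    show ?case using assms(1) u' by (auto simp: vec.subspace_add vec.subspace_scale)
  next
    case 2
    show ?case using assms(1) u' by (auto simp: form_simps vec.subspace_diff vec.subspace_scale)
  next
    case (3 y)
    then show ?case using u' by (auto simp: form_simps)
  next
    case (4 y)
    then show ?case by (simp add: algebra_simps)
  qed
  then show ?thesis using bij_betw_same_card card_field by (fastforce simp: card_cartesian_product)
qed

lemma card_perp:
  assumes "vec.subspace U" "nondeg U" "x \<in> U" "x \<noteq> 0"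
  shows "card U = 3 * card {v \<in> U. B x v = 0}"
proof -
  obtain u where "u \<in> U" "B x u \<noteq> 0" using assms unfolding nondeg_def by blast
  then show ?thesis using card_kernel assms(1) by blast
qed

lemma subspace_perp: "vec.subspace U \<Longrightarrow> vec.subspace {v \<in> U. B x v = 0}"
  unfolding vec.subspace_def by (auto simp: form_simps)

lemma scale_cases: "c *s x = 0 \<or> c *s x = x \<or> c *s x = - x" for x :: "'f ^ 'm"
  using field_cases[of c] by auto

text \<open>If \<open>y\<close> were perpendicular to everything perpendicular to \<open>x\<close>,
  the functional of \<open>y\<close> would be a multiple of that of \<open>x\<close>, and
  nondegeneracy would put \<open>y\<close> among 0, \<open>x\<close>, \<open>- x\<close>.\<close>

lemma card_perp_perp:
  assumes "vec.subspace U" "nondeg U" "x \<in> U" "x \<noteq> 0" "y \<in> U" "y \<noteq> 0" "y \<noteq> x" "y \<noteq> - x"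
  shows "card U = 9 * card {v \<in> U. B x v = 0 \<and> B y v = 0}"
proof -
  have "\<exists>v\<in>{v \<in> U. B x v = 0}. B y v \<noteq> 0"
  proof (rule ccontr)
    assume *: "\<not> ?thesis"
    obtain u where u: "u \<in> U" "B x u \<noteq> 0" using assms(2-4) unfolding nondeg_def by blast
    define c where "c = B y u / B x u"
    have "B (y - c *s x) v = 0" if "v \<in> U" for v
    proof -
      have "v - (B x v / B x u) *s u \<in> {v \<in> U. B x v = 0}"
        using u that assms by (simp add: form_simps vec.subspace_diff vec.subspace_scale)
      then have "B y (v - (B x v / B x u) *s u) = 0" using * by blast
      then show ?thesis using u by (simp add: form_simps c_def field_simps)
    qed
    moreover have "y - c *s x \<in> U" using assms by (simp add: vec.subspace_diff vec.subspace_scale)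
    ultimately have "y = c *s x" using assms(2) unfolding nondeg_def by fastforce
    then show False using scale_cases[of c x] assms by auto
  qed
  then obtain v where "v \<in> {v \<in> U. B x v = 0}" "B y v \<noteq> 0" by blast
  from card_kernel[OF subspace_perp[OF assms(1)] this] card_perp[OF assms(1-4)]
  show ?thesis by (simp add: conj_assoc)
qed

text \<open>Besides nondegeneracy, the later counts use only these two numbers. The pairs that occur
  are 81, 20 and 729, 224 and 6561, 2132, belonging to the elliptic quadrics in dimension 4, 6 and 8
  over the field of order 3, with 10, 112 and 1066 points.\<close>

definition ell :: "('f ^ 'n) set \<Rightarrow> nat \<Rightarrow> nat \<Rightarrow> bool" where
  "ell U c s \<longleftrightarrow> vec.subspace U \<and> nondeg U \<and> card U = c \<and> card (sing U) = s"

lemma ell_perp2: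
  assumes "ell U (9 * c) (2 * c + 3 * s + 2)" "hyp_pair U e f"
  shows "ell (perp2 U e f) c s"
  using assms card_hyp[of U e f] card_sing_hyp[of U e f] subspace_perp2 nondeg_perp2
  unfolding ell_def by auto

text \<open>Sums range over vectors, so each point of the quadric is counted twice; a line of the quadric
  then has total weight \<open>2 * k\<close>, whence the condition on the four points of a line.\<close>

definition weighted_ovoid :: "('f ^ 'n) set \<Rightarrow> int \<Rightarrow> ('f ^ 'n \<Rightarrow> int) \<Rightarrow> bool" where
  "weighted_ovoid U k w \<longleftrightarrow>
     (\<forall>z\<in>U. w (- z) = w z) \<and> (\<forall>z\<in>U - sing U. w z = 0) \<and>
     (\<forall>x\<in>sing U. \<forall>y\<in>sing U. B x y = 0 \<and> y \<noteq> x \<and> y \<noteq> - x \<longrightarrow> w x + w y + w (x + y) + w (x - y) = k)"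

text \<open>The vectors perpendicular to \<open>v\<close> form cosets of the span of
  \<open>v\<close> over a complement with 20 singular vectors. The coset of 0 carries
  \<open>v\<close> and \<open>- v\<close>. The coset of a singular \<open>z\<close> carries the
  points other than \<open>v\<close> of a line on \<open>v\<close>, of weight
  \<open>k - w v\<close>. All other cosets carry nothing.\<close>

lemma sum_perp_sing:
  assumes U: "ell U 729 224" and w: "weighted_ovoid U k w" and v: "v \<in> sing U"
  shows "(\<Sum>z | z \<in> U \<and> B v z = 0. w z) = 20 * k - 18 * w v"
proof -
  have sub: "vec.subspace U" using U by (simp add: ell_def)
  obtain v' where h: "hyp_pair U v v'" using hyp_partner U v unfolding ell_def by metis
  let ?W = "perp2 U v v'"
  have W: "ell ?W 81 20" using U h by (intro ell_perp2) auto
  have W0: "0 \<in> ?W" using subspace_perp2[OF sub] vec.subspace_0 by blast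
  have vU: "v \<in> U" "Q v = 0" "v \<noteq> 0" "B v v = 0" using v hyp_pairD[OF h] by (auto simp: sing_def)
  have *: "(\<Sum>a\<in>UNIV. w (z + a *s v)) = (if z = 0 then 2 * w v else if z \<in> sing ?W then k - w v else 0)"
    if z: "z \<in> ?W" for z
  proof -
    have zU: "z \<in> U" "B v z = 0" using z by (auto simp: perp2_def)
    have zv: "z + v \<in> U" "z - v \<in> U" using vU zU sub by (simp_all add: vec.subspace_add vec.subspace_diff)
    consider "z = 0" | "z \<in> sing ?W" "z \<noteq> 0" | "Q z \<noteq> 0" "z \<noteq> 0" using z by (auto simp: sing_def)
    then show ?thesis
    proof cases
      case 1
      then show ?thesis using w vU zU by (simp add: sum_field weighted_ovoid_def sing_def)
    next
      case 2
      have zs: "z \<in> sing U" using 2 zU by (auto simp: sing_def)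
      have "z \<noteq> v" "z \<noteq> - v" using z hyp_pairD[OF h] by (auto simp: perp2_def)
      then have "w v + w z + w (v + z) + w (v - z) = k"
        using w v zs zU unfolding weighted_ovoid_def by blast
      moreover have "w (v - z) = w (z - v)"
        using w zv(2) unfolding weighted_ovoid_def by (metis minus_diff_eq)
      ultimately show ?thesis using 2 by (simp add: sum_field add.commute)
    next
      case 3
      have "B z v = 0" using zU B_sym by metis
      then have "z + v \<notin> sing U" "z - v \<notin> sing U" "z \<notin> sing U"
        using 3 vU by (simp_all add: sing_def form_simps)
      then show ?thesis using w zU zv 3 by (simp add: sum_field weighted_ovoid_def sing_def)
    qed
  qed
  have "(\<Sum>z | z \<in> U \<and> B v z = 0. w z) =
      (\<Sum>z\<in>?W. if z = 0 then 2 * w v else if z \<in> sing ?W then k - w v else 0)"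
    unfolding sum_perp_hyp[OF sub h] by (rule sum.cong) (use * in auto)
  also have "\<dots> = (\<Sum>z\<in>insert 0 (sing ?W). if z = 0 then 2 * w v else if z \<in> sing ?W then k - w v else 0)"
    by (rule sum.mono_neutral_right) (use W0 in \<open>auto simp: sing_def\<close>)
  also have "\<dots> = 2 * w v + (\<Sum>z\<in>sing ?W. k - w v)"
    by (subst sum.insert) (auto simp: sing_def intro!: sum.cong)
  also have "\<dots> = 20 * k - 18 * w v" using W by (simp add: ell_def algebra_simps)
  finally show ?thesis .
qed

text \<open>The whole point set meets each line in 4 points. Used as a weight in
  \<open>sum_perp_sing\<close>, it yields the count 62 in \<open>card_sing_perp\<close>.\<close>

lemma weighted_ovoid_const:
  assumes "vec.subspace U"
  shows "weighted_ovoid U 4 (\<lambda>z. of_bool (z \<in> sing U))"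
  unfolding weighted_ovoid_def
proof (intro conjI ballI impI, goal_cases)
  case (1 z)
  then show ?case using assms vec.subspace_neg[of U] vec.subspace_neg[of U "- z"] by (auto simp: sing_def)
next
  case (3 x y)
  then have "x + y \<in> sing U" "x - y \<in> sing U"
    using assms by (auto simp: sing_def form_simps vec.subspace_add vec.subspace_diff add_eq_0_iff)
  then show ?case using 3 by simp
qed simp

section \<open>Spans in coordinates and sizes of subspaces\<close>

text \<open>For a subspace \<open>U\<close> this is the span of \<open>U\<close> and
  \<open>x\<close>, kept as an image of coordinate pairs so that sizes and sums over it can be
  computed.\<close>

definition adjoin :: "'f ^ 'n \<Rightarrow> ('f ^ 'n) set \<Rightarrow> ('f ^ 'n) set" where
  "adjoin x U = (\<lambda>(a, u). a *s x + u) ` (UNIV \<times> U)"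

lemma adjoinI: "u \<in> U \<Longrightarrow> a *s x + u \<in> adjoin x U"
  unfolding adjoin_def by force

lemma adjoinE:
  assumes "y \<in> adjoin x U" obtains a u where "u \<in> U" "y = a *s x + u"
  using assms unfolding adjoin_def by auto

lemma subspace_adjoin:
  assumes "vec.subspace U"
  shows "vec.subspace (adjoin x U)"
proof (rule vec.subspaceI)
  show "0 \<in> adjoin x U" using adjoinI[OF vec.subspace_0[OF assms], of 0 x] by simp
next
  fix y z assume "y \<in> adjoin x U" "z \<in> adjoin x U"
  then obtain a u b v where "u \<in> U" "v \<in> U" "y = a *s x + u" "z = b *s x + v"
    by (metis adjoinE)
  then show "y + z \<in> adjoin x U"
    using adjoinI[of "u + v" U "a + b" x] assms
    by (simp add: vec.subspace_add vec.scale_left_distrib algebra_simps)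
next
  fix c y assume "y \<in> adjoin x U"
  then obtain a u where "u \<in> U" "y = a *s x + u" by (metis adjoinE)
  then show "c *s y \<in> adjoin x U"
    using adjoinI[of "c *s u" U "c * a" x] assms
    by (simp add: vec.subspace_scale vec.scale_right_distrib)
qed

lemma card_adjoin:
  assumes "vec.subspace U" "x \<notin> U"
  shows "card (adjoin x U) = 3 * card U"
proof -
  have "inj_on (\<lambda>(a, u). a *s x + u) (UNIV \<times> U)"
  proof (rule inj_onI, clarify)
    fix a u b v assume *: "u \<in> U" "v \<in> U" "a *s x + u = b *s x + v"
    have "(a - b) *s x = v - u" using *(3) by (simp add: vec.scale_left_diff_distrib algebra_simps)
    then have d: "(a - b) *s x \<in> U" using * assms vec.subspace_diff by metis
    have "a = b"
    proof (rule ccontr)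
      assume "a \<noteq> b"
      then have "inverse (a - b) *s ((a - b) *s x) = x" by simp
      then show False using vec.subspace_scale[OF assms(1) d] assms(2) by metis
    qed
    then show "a = b \<and> u = v" using *(3) by simp
  qed
  then show ?thesis unfolding adjoin_def by (simp add: card_image card_cartesian_product card_field)
qed

lemma span_insert_adjoin: "vec.span (insert x S) = adjoin x (vec.span S)"
proof (intro set_eqI iffI)
  fix y assume "y \<in> vec.span (insert x S)"
  then obtain k where "y - k *s x \<in> vec.span S" by (auto simp: vec.span_insert)
  from adjoinI[OF this, of k x] show "y \<in> adjoin x (vec.span S)" by simp
next
  fix y assume "y \<in> adjoin x (vec.span S)"
  then obtain a u where "u \<in> vec.span S" "y = a *s x + u" by (metis adjoinE)
  then show "y \<in> vec.span (insert x S)" by (auto simp: vec.span_insert intro!: exI[of _ a])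
qed

lemma card_span_independent:
  fixes S :: "('f ^ 'n) set"
  assumes "finite S" "vec.independent S"
  shows "card (vec.span S) = 3 ^ card S"
  using assms
proof (induction S rule: finite_induct)
  case (insert x S)
  then have "x \<notin> vec.span S" "vec.independent S"
    by (auto simp: vec.independent_insert)
  then show ?case using insert card_adjoin[OF vec.subspace_span] by (simp add: span_insert_adjoin)
qed simp

lemma card_subspace:
  fixes U :: "('f ^ 'n) set"
  assumes "vec.subspace U"
  shows "card U = 3 ^ vec.dim U"
proof -
  obtain S where "S \<subseteq> U" "vec.independent S" "U \<subseteq> vec.span S" "card S = vec.dim U"
    by (rule vec.basis_exists)
  moreover from this have "vec.span S = U" using assms vec.span_subspace by blast
  ultimately show ?thesis using card_span_independent[of S] by simp
qed

section \<open>Witt index and the two numbers of the quadric\<close>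

text \<open>Excluding the exponent \<open>Suc j\<close> alone bounds the index, since a larger
  totally singular subspace contains one of that size.\<close>

definition witt :: "('f ^ 'n) set \<Rightarrow> nat \<Rightarrow> bool" where
  "witt W j \<longleftrightarrow> (\<exists>U\<subseteq>W. totally_singular Q U \<and> card U = 3 ^ j) \<and>
     (\<forall>U\<subseteq>W. totally_singular Q U \<longrightarrow> card U \<noteq> 3 ^ Suc j)"

lemma totally_singular_perp: "totally_singular Q U \<Longrightarrow> x \<in> U \<Longrightarrow> y \<in> U \<Longrightarrow> B x y = 0"
  using vec.subspace_add[of U x y] by (auto simp: totally_singular_def polar_def)

lemma totally_singular_adjoin:
  assumes "totally_singular Q U" "Q x = 0" "\<And>u. u \<in> U \<Longrightarrow> B x u = 0"
  shows "totally_singular Q (adjoin x U)"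
  using assms subspace_adjoin unfolding totally_singular_def
  by (auto simp: form_simps elim!: adjoinE)

text \<open>For \<open>e\<close> in a totally singular \<open>U\<close> of top dimension, the
  vectors of \<open>U\<close> perpendicular to \<open>f\<close> lie in \<open>perp2 W e f\<close>
  and lose one dimension. Conversely, a totally singular subspace of \<open>perp2 W e f\<close>
  gains one by adjoining \<open>e\<close>.\<close>

lemma witt_step:
  assumes W: "vec.subspace W" "nondeg W" and "witt W (Suc j)"
  obtains e f where "hyp_pair W e f" "witt (perp2 W e f) j"
proof -
  obtain U where U: "U \<subseteq> W" "totally_singular Q U" "card U = 3 ^ Suc j"
    using assms unfolding witt_def by blast
  have "(1::nat) < 3 ^ Suc j" by (rule one_less_power) auto
  then have "\<not> U \<subseteq> {0}" using card_mono[of "{0}" U] U(3) by auto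
  then obtain e where e: "e \<in> U" "e \<noteq> 0" by blast
  then have "e \<in> sing W" using U by (auto simp: sing_def totally_singular_def)
  then obtain f where h: "hyp_pair W e f" using hyp_partner W by blast
  note s = hyp_pairD[OF h]
  have sU: "vec.subspace U" using U by (simp add: totally_singular_def)
  have "witt (perp2 W e f) j"
    unfolding witt_def
  proof (intro conjI allI impI)
    show "\<exists>U\<subseteq>perp2 W e f. totally_singular Q U \<and> card U = 3 ^ j"
    proof (intro exI[of _ "{v \<in> U. B f v = 0}"] conjI)
      show "{v \<in> U. B f v = 0} \<subseteq> perp2 W e f"
        using totally_singular_perp[OF U(2) e(1)] U(1) by (auto simp: perp2_def)
      show "totally_singular Q {v \<in> U. B f v = 0}"
        using U(2) subspace_perp[OF sU] by (auto simp: totally_singular_def)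
      show "card {v \<in> U. B f v = 0} = 3 ^ j"
        using card_kernel[OF sU e(1), of f] s(6) U(3) by simp
    qed
  next
    fix U' assume U': "U' \<subseteq> perp2 W e f" "totally_singular Q U'"
    have "e \<notin> U'" using U' s by (auto simp: perp2_def)
    then have "card (adjoin e U') = 3 * card U'"
      using U' by (simp add: card_adjoin totally_singular_def)
    moreover have "totally_singular Q (adjoin e U')"
      using U' s by (intro totally_singular_adjoin) (auto simp: perp2_def)
    moreover have "adjoin e U' \<subseteq> W"
      using U' s W by (auto simp: perp2_def elim!: adjoinE intro!: vec.subspace_add vec.subspace_scale)
    ultimately have "3 * card U' \<noteq> 3 ^ Suc (Suc j)"
      using assms(3) unfolding witt_def by metis
    then show "card U' \<noteq> 3 ^ Suc j" by simp
  qed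
  with h show ?thesis using that by blast
qed

lemma sing_witt_0:
  assumes "vec.subspace W" "witt W 0"
  shows "sing W = {}"
proof (rule equals0I)
  fix z assume z: "z \<in> sing W"
  have ts: "totally_singular Q {0}" by (simp add: totally_singular_def)
  have "totally_singular Q (adjoin z {0})"
    using z ts by (intro totally_singular_adjoin) (auto simp: sing_def)
  moreover have "card (adjoin z {0}) = 3 ^ Suc 0"
    using z card_adjoin[of "{0}" z] by (simp add: sing_def)
  moreover have "adjoin z {0} \<subseteq> W"
    using z assms(1) by (auto simp: sing_def elim!: adjoinE intro!: vec.subspace_scale)
  ultimately show False using assms(2) unfolding witt_def by blast
qed

text \<open>Splitting off three hyperbolic planes leaves an anisotropic space of size 9. Going back
  up, the numbers of all and of singular vectors are 9, 0, then 81, 20, then 729, 224, then 6561,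
  2132.\<close>

lemma ell_of_witt:
  assumes "vec.subspace W" "nondeg W" "witt W 3" "card W = 6561"
  shows "ell W 6561 2132"
proof -
  obtain e1 f1 where 1: "hyp_pair W e1 f1" "witt (perp2 W e1 f1) 2"
    using witt_step[of W 2] assms by (auto simp: eval_nat_numeral)
  let ?W1 = "perp2 W e1 f1"
  have W1: "vec.subspace ?W1" "nondeg ?W1"
    using assms 1 subspace_perp2 nondeg_perp2 by auto
  obtain e2 f2 where 2: "hyp_pair ?W1 e2 f2" "witt (perp2 ?W1 e2 f2) 1"
    using witt_step[of ?W1 1] W1 1(2) by (auto simp: eval_nat_numeral)
  let ?W2 = "perp2 ?W1 e2 f2"
  have W2: "vec.subspace ?W2" "nondeg ?W2"
    using W1 2 subspace_perp2 nondeg_perp2 by auto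
  obtain e3 f3 where 3: "hyp_pair ?W2 e3 f3" "witt (perp2 ?W2 e3 f3) 0"
    using witt_step[of ?W2 0] W2 2(2) by (auto simp: eval_nat_numeral)
  have "sing (perp2 ?W2 e3 f3) = {}"
    using sing_witt_0[OF subspace_perp2[OF W2(1)] 3(2)] .
  then show ?thesis
    using card_hyp[OF assms(1) 1(1)] card_hyp[OF W1(1) 2(1)] card_hyp[OF W2(1) 3(1)]
      card_sing_hyp[OF assms(1) 1(1)] card_sing_hyp[OF W1(1) 2(1)] card_sing_hyp[OF W2(1) 3(1)] assms
    by (simp add: ell_def)
qed

section \<open>Lines and planes of the quadric given by spanning vectors\<close>

definition indep3 :: "'f ^ 'n \<Rightarrow> 'f ^ 'n \<Rightarrow> 'f ^ 'n \<Rightarrow> bool" where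
  "indep3 p x y \<longleftrightarrow> (\<forall>a b c. a *s p + b *s x + c *s y = 0 \<longrightarrow> a = 0 \<and> b = 0 \<and> c = 0)"

text \<open>Spanning vectors of a line of the quadric: as the only scalars are 0, 1 and -1,
  excluding \<open>p\<close> and \<open>- p\<close> is linear independence.\<close>

definition sing_line :: "'f ^ 'n \<Rightarrow> 'f ^ 'n \<Rightarrow> bool" where
  "sing_line p r \<longleftrightarrow> p \<in> sing UNIV \<and> r \<in> sing UNIV \<and> B p r = 0 \<and> r \<noteq> p \<and> r \<noteq> - p"

lemma sing_line_indep:
  assumes "sing_line p r" "a *s p + b *s r = 0"
  shows "a = 0 \<and> b = 0"
proof -
  have "p \<noteq> 0" "r \<noteq> 0" "r \<noteq> p" "r \<noteq> - p" using assms by (auto simp: sing_line_def sing_def)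
  moreover from this have "p \<noteq> - r" by auto
  ultimately show ?thesis
    using assms(2) field_cases[of a] field_cases[of b] by (auto simp: add_eq_0_iff2)
qed

lemma sing_line_sum_diff:
  assumes "sing_line p r"
  shows "sing_line r p" "sing_line (p + r) r" "sing_line (p - r) r" "p + r \<in> sing UNIV" "p - r \<in> sing UNIV"
proof -
  have *: "p \<noteq> 0" "r \<noteq> 0" "r \<noteq> p" "r \<noteq> - p" "p \<noteq> - r" "p \<noteq> r" "Q p = 0" "Q r = 0" "B p r = 0" "B r p = 0" "B r r = 0"
    using assms B_sym[of p r] B_self[of r] by (auto simp: sing_line_def sing_def)
  then show "sing_line r p" "p + r \<in> sing UNIV" "p - r \<in> sing UNIV"
    by (auto simp: sing_line_def sing_def form_simps eq_neg_iff_add_eq_0)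
  moreover have "r \<noteq> - (p + r)" "r \<noteq> p - r"
  proof -
    show "r \<noteq> - (p + r)"
    proof
      assume "r = - (p + r)"
      then have "p + (r + r) = 0" by (simp add: algebra_simps eq_neg_iff_add_eq_0)
      then show False using * by (simp add: double)
    qed
    show "r \<noteq> p - r"
    proof
      assume "r = p - r"
      then have "r + r = p" by (simp add: algebra_simps)
      then show False using * by (simp add: double)
    qed
  qed
  ultimately show "sing_line (p + r) r" "sing_line (p - r) r"
    using * by (auto simp: sing_line_def sing_def form_simps)
qed

lemma bij_adjoin:
  assumes "vec.subspace U" "x \<notin> U"
  shows "bij_betw (\<lambda>(a, u). a *s x + u) (UNIV \<times> U) (adjoin x U)"
  unfolding adjoin_def
  by (rule inj_on_imp_bij_betw, rule eq_card_imp_inj_on)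
    (use card_adjoin[OF assms] in \<open>simp_all add: adjoin_def card_cartesian_product card_field\<close>)

lemma sum_adjoin:
  assumes "vec.subspace U" "x \<notin> U"
  shows "sum g (adjoin x U) = (\<Sum>a\<in>UNIV. \<Sum>u\<in>U. g (a *s x + u))"
  unfolding sum.reindex_bij_betw[OF bij_adjoin[OF assms], symmetric]
  by (simp add: sum.cartesian_product split_def)

lemma sing_line_span:
  assumes "sing_line p r"
  shows sum_sing_line: "sum g (vec.span {p, r}) = (\<Sum>a\<in>UNIV. \<Sum>b\<in>UNIV. g (a *s p + b *s r))"
    and card_sing_line: "card (vec.span {p, r}) = 9"
    and totally_singular_sing_line: "totally_singular Q (vec.span {p, r})"
proof -
  have r: "r \<notin> {0}" using assms by (auto simp: sing_line_def sing_def)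
  have p: "p \<notin> adjoin r {0}"
  proof
    assume "p \<in> adjoin r {0}"
    then obtain b where "p = b *s r" by (elim adjoinE) auto
    then have "1 *s p + (- b) *s r = 0" by simp
    then show False using sing_line_indep[OF assms] by fastforce
  qed
  have span: "vec.span {p, r} = adjoin p (adjoin r {0})" by (simp add: span_insert_adjoin)
  have s0: "vec.subspace {0::'f ^ 'n}" by simp
  note s1 = subspace_adjoin[OF s0, of r]
  show "sum g (vec.span {p, r}) = (\<Sum>a\<in>UNIV. \<Sum>b\<in>UNIV. g (a *s p + b *s r))"
    unfolding span sum_adjoin[OF s1 p] sum_adjoin[OF s0 r] by simp
  show "card (vec.span {p, r}) = 9"
    unfolding span card_adjoin[OF s1 p] card_adjoin[OF s0 r] by simp
  show "totally_singular Q (vec.span {p, r})"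
    unfolding span using assms
    by (intro totally_singular_adjoin)
      (auto simp: sing_line_def sing_def totally_singular_def form_simps elim!: adjoinE)
qed

lemma indep3_sing_line:
  assumes "indep3 p x y" "p \<in> sing UNIV" "x \<in> sing UNIV" "y \<in> sing UNIV" "B p x = 0" "B p y = 0" "B x y = 0"
  shows "sing_line (x + a *s p) (y + b *s p)"
proof -
  have ind: "\<And>a b c. a *s p + b *s x + c *s y = 0 \<Longrightarrow> a = 0 \<and> b = 0 \<and> c = 0"
    using assms(1) unfolding indep3_def by blast
  have "x + a *s p \<noteq> 0" using ind[of a 1 0] by (auto simp: algebra_simps)
  moreover have "y + b *s p \<noteq> 0" using ind[of b 0 1] by (auto simp: algebra_simps)
  moreover have "y + b *s p \<noteq> x + a *s p"
    using ind[of "b - a" "-1" 1] by (auto simp: algebra_simps vec.scale_left_diff_distrib)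
  moreover have "y + b *s p \<noteq> - (x + a *s p)"
  proof
    assume "y + b *s p = - (x + a *s p)"
    then have "(a + b) *s p + 1 *s x + 1 *s y = 0"
      by (simp add: vec.scale_left_distrib add_eq_0_iff2 algebra_simps)
    then show False using ind by fastforce
  qed
  moreover have "B x p = 0" "B y p = 0" "B p p = 0"
    using assms B_sym[of x p] B_sym[of y p] B_self[of p] by (auto simp: sing_def)
  ultimately show ?thesis using assms by (auto simp: sing_line_def sing_def form_simps)
qed

section \<open>Points as pairs of vectors\<close>

lemma card_dim: "vec.subspace U \<Longrightarrow> card U = 3 ^ d \<longleftrightarrow> vec.dim U = d" for U :: "('f ^ 'n) set"
  using card_subspace by simp

lemma card_vectors_on_points:
  fixes \<P> :: "('f ^ 'n) set set"
  assumes "\<And>P. P \<in> \<P> \<Longrightarrow> vec.subspace P \<and> vec.dim P = 1"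
  shows "card {v. v \<noteq> 0 \<and> vec.span {v} \<in> \<P>} = 2 * card \<P>"
proof -
  have "{v. v \<noteq> 0 \<and> vec.span {v} \<in> \<P>} = (\<Union>P\<in>\<P>. P - {0})"
    using assms span_singleton_eq by (auto intro: vec.span_base)
  also have "card \<dots> = (\<Sum>P\<in>\<P>. card (P - {0}))"
  proof (rule card_UN_disjoint)
    show "\<forall>P\<in>\<P>. \<forall>P'\<in>\<P>. P \<noteq> P' \<longrightarrow> (P - {0}) \<inter> (P' - {0}) = {}"
      using assms span_singleton_eq by blast
  qed simp_all
  also have "\<dots> = (\<Sum>P\<in>\<P>. 2)"
  proof (rule sum.cong[OF refl])
    fix P assume "P \<in> \<P>"
    then have "card P = 3" "0 \<in> P" using assms card_subspace[of P] vec.subspace_0 by auto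
    then show "card (P - {0}) = 2" by simp
  qed
  finally show ?thesis by simp
qed

lemma span_point: "v \<noteq> 0 \<Longrightarrow> v \<in> U \<Longrightarrow> vec.subspace U \<Longrightarrow> vec.span {v} \<in> points_on U"
  for v :: "'f ^ 'n"
  by (simp add: points_on_def vec.span_minimal)

lemma point_generator:
  fixes P :: "('f ^ 'n) set"
  assumes "vec.subspace P" "vec.dim P = 1"
  obtains v where "v \<in> P" "v \<noteq> 0" "P = vec.span {v}"
proof -
  have "\<not> P \<subseteq> {0}" using assms vec.dim_subset[of P "{0}"] by auto
  then obtain v where "v \<in> P" "v \<noteq> 0" by blast
  then show ?thesis using that span_singleton_eq[OF assms] by metis
qed

lemma card_points_on_line:
  assumes "l \<in> quadric_lines Q"
  shows "card (points_on l) = 4"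
proof -
  have l: "vec.subspace l" "card l = 9"
    using assms card_subspace[of l] by (auto simp: quadric_lines_def totally_singular_def)
  have "{v. v \<noteq> 0 \<and> vec.span {v} \<in> points_on l} = l - {0}"
    using l(1) span_point vec.span_base by (fastforce simp: points_on_def)
  then have "2 * card (points_on l) = card (l - {0})"
    using card_vectors_on_points[of "points_on l"] by (simp add: points_on_def)
  then show ?thesis using l vec.subspace_0[OF l(1)] by simp
qed

lemma sing_plane_span:
  assumes "sing_line p x" "sing_line p y" "B x y = 0" "indep3 p x y"
  shows sum_sing_plane: "sum g (vec.span {p, x, y}) = (\<Sum>a\<in>UNIV. \<Sum>b\<in>UNIV. \<Sum>c\<in>UNIV. g (a *s p + b *s x + c *s y))"
    and sing_plane_quadric: "vec.span {p, x, y} \<in> quadric_planes Q"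
proof -
  have ind: "\<And>a b c. a *s p + b *s x + c *s y = 0 \<Longrightarrow> a = 0 \<and> b = 0 \<and> c = 0"
    using assms(4) unfolding indep3_def by blast
  have sing: "p \<in> sing UNIV" "x \<in> sing UNIV" "y \<in> sing UNIV" "B p x = 0" "B p y = 0"
    using assms by (auto simp: sing_line_def)
  have l: "sing_line x y" using indep3_sing_line[OF assms(4) sing assms(3), of 0 0] by simp
  have p: "p \<notin> vec.span {x, y}"
  proof
    assume "p \<in> vec.span {x, y}"
    then have "p \<in> adjoin x (adjoin y {0})" by (simp add: span_insert_adjoin)
    then obtain b c where "p = b *s x + c *s y" by (elim adjoinE) auto
    then have "(-1) *s p + b *s x + c *s y = 0" by simp
    then show False using ind by fastforce
  qed
  have span: "vec.span {p, x, y} = adjoin p (vec.span {x, y})" by (rule span_insert_adjoin)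
  show "sum g (vec.span {p, x, y}) = (\<Sum>a\<in>UNIV. \<Sum>b\<in>UNIV. \<Sum>c\<in>UNIV. g (a *s p + b *s x + c *s y))"
    unfolding span sum_adjoin[OF vec.subspace_span p] sum_sing_line[OF l] by (simp add: add.assoc)
  have ts: "totally_singular Q (vec.span {x, y})" by (rule totally_singular_sing_line[OF l])
  have "B p u = 0" if "u \<in> vec.span {x, y}" for u
    using that sing by (auto simp: span_insert_adjoin form_simps elim!: adjoinE)
  then have "totally_singular Q (vec.span {p, x, y})"
    unfolding span using ts sing by (intro totally_singular_adjoin) (auto simp: sing_def)
  moreover have "card (vec.span {p, x, y}) = 3 ^ 3"
    unfolding span card_adjoin[OF vec.subspace_span p] card_sing_line[OF l] by simp
  then have "vec.dim (vec.span {p, x, y}) = 3" unfolding card_dim[OF vec.subspace_span] .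
  ultimately show "vec.span {p, x, y} \<in> quadric_planes Q" unfolding quadric_planes_def by blast
qed

subsection \<open>Weighted ovoids of the elliptic quadric in six-dimensional space\<close>

lemma perp_commute: "{v \<in> U. B v z = 0} = {v \<in> U. B z v = 0}"
  using B_sym by metis

context
  fixes U :: "('f ^ 'n) set" and k :: int and w :: "'f ^ 'n \<Rightarrow> int"
  assumes ell: "ell U 729 224" and w: "weighted_ovoid U k w"
begin

lemma ell_facts: "vec.subspace U" "nondeg U" "card U = 729" "card (sing U) = 224" "0 \<in> U"
  using ell vec.subspace_0 by (auto simp: ell_def)

lemma w_outside: "z \<in> U \<Longrightarrow> z \<notin> sing U \<Longrightarrow> w z = 0"
  and w_minus: "z \<in> U \<Longrightarrow> w (- z) = w z"
  using w by (auto simp: weighted_ovoid_def)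

lemma w_zero: "w 0 = 0"
  using w_outside[OF ell_facts(5)] by (simp add: sing_def)

lemma card_sing_perp:
  assumes "v \<in> sing U"
  shows "card {z \<in> sing U. B z v = 0} = 62"
proof -
  have "int (card {z \<in> sing U. B z v = 0}) = (\<Sum>z | z \<in> U \<and> B v z = 0. of_bool (z \<in> sing U))"
  proof -
    have "{z. z \<in> U \<and> B v z = 0} \<inter> {z. z \<in> sing U} = {z \<in> sing U. B z v = 0}"
      using B_sym[of v] by (auto simp: sing_def)
    then show ?thesis by (simp add: sum.If_cases of_bool_def)
  qed
  also have "\<dots> = 62"
    using sum_perp_sing[OF ell weighted_ovoid_const[OF ell_facts(1)] assms] assms by simp
  finally show ?thesis by simp
qed

lemma weight_total: "(\<Sum>z\<in>U. w z) = 56 * k"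
proof -
  have S: "(\<Sum>z\<in>U. w z) = (\<Sum>z\<in>sing U. w z)"
    by (rule sum.mono_neutral_right) (auto simp: sing_def intro!: w_outside)
  have "(\<Sum>v\<in>sing U. \<Sum>z | z \<in> U \<and> B v z = 0. w z) = (\<Sum>z\<in>U. \<Sum>v | v \<in> sing U \<and> B v z = 0. w z)"
    by (rule sum.swap_restrict) auto
  also have "\<dots> = (\<Sum>z\<in>U. 62 * w z)"
    by (rule sum.cong) (use w_outside card_sing_perp in auto)
  finally have "62 * (\<Sum>z\<in>U. w z) = (\<Sum>v\<in>sing U. 20 * k - 18 * w v)"
    using sum_perp_sing[OF ell w] by (simp flip: sum_distrib_left)
  then show ?thesis using ell_facts(4) unfolding S by (simp add: sum_subtractf flip: sum_distrib_left)
qed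

text \<open>The moments of \<open>H\<close> come from 243 vectors being perpendicular to one given
  nonzero vector and 81 to two independent ones. The deviation of \<open>H\<close> from
  \<open>20 * k\<close> is \<open>36 * k\<close> at 0 and \<open>-18 * w v\<close> at a singular
  \<open>v\<close>.\<close>

lemma sum_perp_nonsing:
  assumes "v \<in> U" "Q v \<noteq> 0"
  shows "(\<Sum>z | z \<in> U \<and> B v z = 0. w z) = 20 * k"
proof -
  define H where "H v = (\<Sum>z | z \<in> U \<and> B v z = 0. w z)" for v
  define T where "T = (\<Sum>z\<in>U. w z * w z)"
  have c1: "card {v \<in> U. B v z = 0} = 243" if "z \<in> sing U" for z
    using card_perp[of U z] ell_facts that unfolding perp_commute by (auto simp: sing_def)
  have c2: "card {v. (v \<in> U \<and> B v z = 0) \<and> B v z' = 0} = (if z' = z \<or> z' = - z then 243 else 81)"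
    if "z \<in> sing U" "z' \<in> sing U" for z z'
  proof (cases "z' = z \<or> z' = - z")
    case True
    then have "{v. (v \<in> U \<and> B v z = 0) \<and> B v z' = 0} = {v \<in> U. B v z = 0}" by auto
    then show ?thesis using True c1 that by simp
  next
    case False
    have "{v. (v \<in> U \<and> B v z = 0) \<and> B v z' = 0} = {v \<in> U. B z v = 0 \<and> B z' v = 0}"
      using B_sym[of z] B_sym[of z'] by auto
    then show ?thesis using False card_perp_perp[of U z z'] ell_facts that by (simp add: sing_def)
  qed
  have "(\<Sum>v\<in>U. H v) = (\<Sum>z\<in>U. \<Sum>v | v \<in> U \<and> B v z = 0. w z)"
    unfolding H_def by (rule sum.swap_restrict) auto
  also have "\<dots> = (\<Sum>z\<in>U. 243 * w z)"
    by (rule sum.cong) (use w_outside c1 in auto)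
  finally have S1: "(\<Sum>v\<in>U. H v) = 243 * (56 * k)" by (simp add: weight_total flip: sum_distrib_left)
  have perp_sum: "(\<Sum>v | v \<in> U \<and> B v z = 0. H v) = 81 * (56 * k) + 324 * w z" if z: "z \<in> sing U" for z
  proof -
    have "(\<Sum>v | v \<in> U \<and> B v z = 0. H v) =
        (\<Sum>z'\<in>U. \<Sum>v | v \<in> {v. v \<in> U \<and> B v z = 0} \<and> B v z' = 0. w z')"
      unfolding H_def by (rule sum.swap_restrict) auto
    \<comment> \<open>The generic count is 81; at \<open>z\<close> and \<open>- z\<close> there is
      an excess of 243 - 81 = 162.\<close>
    also have "\<dots> = (\<Sum>z'\<in>U. 81 * w z' + (if z' = z then 162 * w z else 0) + (if z' = - z then 162 * w z else 0))"
    proof (rule sum.cong[OF refl])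
      fix z' assume z': "z' \<in> U"
      have nz: "z \<noteq> - z" using z vec_neq_minus[of z] unfolding sing_def by blast
      have mz: "- z \<in> sing U" "w (- z) = w z" using z ell_facts(1) vec.subspace_neg w_minus by (auto simp: sing_def)
      show "(\<Sum>v | v \<in> {v. v \<in> U \<and> B v z = 0} \<and> B v z' = 0. w z') =
          81 * w z' + (if z' = z then 162 * w z else 0) + (if z' = - z then 162 * w z else 0)"
      proof (cases "z' \<in> sing U")
        case True
        then show ?thesis using c2[OF z True] nz mz by auto
      next
        case False
        then show ?thesis using w_outside[OF z'] z mz by auto
      qed
    qed
    also have "\<dots> = 81 * (56 * k) + 324 * w z"
      using z vec.subspace_neg[OF ell_facts(1), of z]
      by (simp add: sum.distrib weight_total sing_def flip: sum_distrib_left)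
    finally show ?thesis .
  qed
  have "(\<Sum>v\<in>U. H v * H v) = (\<Sum>v\<in>U. \<Sum>z | z \<in> U \<and> B v z = 0. w z * H v)"
    by (simp add: H_def sum_distrib_right)
  also have "\<dots> = (\<Sum>z\<in>U. \<Sum>v | v \<in> U \<and> B v z = 0. w z * H v)"
    by (rule sum.swap_restrict) auto
  also have "\<dots> = (\<Sum>z\<in>U. 81 * (56 * k) * w z + 324 * (w z * w z))"
  proof (rule sum.cong[OF refl])
    fix z assume "z \<in> U"
    then have "w z * (\<Sum>v | v \<in> U \<and> B v z = 0. H v) = 81 * (56 * k) * w z + 324 * (w z * w z)"
      using perp_sum w_outside[of z] by (cases "z \<in> sing U") (simp_all add: algebra_simps)
    then show "(\<Sum>v | v \<in> U \<and> B v z = 0. w z * H v) = 81 * (56 * k) * w z + 324 * (w z * w z)"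
      by (simp add: sum_distrib_left)
  qed
  also have "\<dots> = 81 * (56 * k) * (56 * k) + 324 * T"
    by (simp add: sum.distrib T_def weight_total flip: sum_distrib_left)
  finally have S2: "(\<Sum>v\<in>U. H v * H v) = 81 * (56 * k) * (56 * k) + 324 * T" .
  \<comment> \<open>The zero vector and the singular vectors already account for the whole variance.\<close>
  have S: "(\<Sum>v\<in>U. (H v - 20 * k)\<^sup>2) = 1296 * k\<^sup>2 + 324 * T"
  proof -
    have "(\<Sum>v\<in>U. (H v - 20 * k)\<^sup>2) = (\<Sum>v\<in>U. H v * H v - 40 * k * H v + 400 * k\<^sup>2)"
      by (intro sum.cong) (simp_all add: power2_eq_square algebra_simps)
    also have "\<dots> = (\<Sum>v\<in>U. H v * H v) - 40 * k * (\<Sum>v\<in>U. H v) + 729 * (400 * k\<^sup>2)"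
      by (simp add: sum.distrib sum_subtractf ell_facts flip: sum_distrib_left)
    also have "\<dots> = 1296 * k\<^sup>2 + 324 * T"
      unfolding S1 S2 by (simp add: power2_eq_square)
    finally show ?thesis .
  qed
  have "(\<Sum>v\<in>sing U. (H v - 20 * k)\<^sup>2) = (\<Sum>v\<in>sing U. 324 * (w v * w v))"
    using sum_perp_sing[OF ell w] by (intro sum.cong) (auto simp: H_def power2_eq_square)
  also have "\<dots> = 324 * T"
    unfolding T_def by (subst sum_distrib_left[symmetric], intro arg_cong2[where f = "(*)"] refl sum.mono_neutral_left)
      (auto simp: sing_def intro!: w_outside)
  finally have Ss: "(\<Sum>v\<in>sing U. (H v - 20 * k)\<^sup>2) = 324 * T" .
  have H0: "H 0 = 56 * k" by (simp add: H_def weight_total)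
  have Un: "U = insert 0 (sing U \<union> {v \<in> U. Q v \<noteq> 0})" using ell_facts(5) by (auto simp: sing_def)
  have "(\<Sum>v\<in>U. (H v - 20 * k)\<^sup>2) = 1296 * k\<^sup>2 + (324 * T + (\<Sum>v | v \<in> U \<and> Q v \<noteq> 0. (H v - 20 * k)\<^sup>2))"
    unfolding Ss[symmetric]
    by (subst Un, subst sum.insert, simp, simp add: sing_def, subst sum.union_disjoint)
      (auto simp: sing_def H0 power2_eq_square)
  then have "(\<Sum>v | v \<in> U \<and> Q v \<noteq> 0. (H v - 20 * k)\<^sup>2) = 0" using S by simp
  then have "(H v - 20 * k)\<^sup>2 = 0"
    using assms by (subst (asm) sum_nonneg_eq_0_iff) auto
  then show ?thesis by (simp add: H_def)
qed

lemma sum_perp: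
  assumes "v \<in> U" "v \<noteq> 0"
  shows "(\<Sum>z | z \<in> U \<and> B v z = 0. w z) = 20 * k - 18 * w v"
  using assms sum_perp_nonsing[of v] sum_perp_sing[OF ell w, of v] w_outside[of v]
  by (cases "Q v = 0") (auto simp: sing_def)

text \<open>By linearity, \<open>z\<close> is perpendicular to all four points \<open>r\<close>,
  \<open>s\<close>, \<open>r + s\<close>, \<open>r - s\<close> of the line or to exactly one of
  them. So one plus twice the number of these points perpendicular to \<open>z\<close> is 9 or
  3.\<close>

lemma sum_perp_perp:
  assumes "r \<in> U" "s \<in> U" "r \<noteq> 0" "s \<noteq> 0" "s \<noteq> r" "s \<noteq> - r"
  shows "(\<Sum>z | z \<in> U \<and> B r z = 0 \<and> B s z = 0. w z) = 8 * k - 6 * (w r + w s + w (r + s) + w (r - s))"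
proof -
  define H where "H v = (\<Sum>z\<in>U. if B v z = 0 then w z else 0)" for v
  have H: "H v = 20 * k - 18 * w v" if "v \<in> U" "v \<noteq> 0" for v
    using sum_perp[OF that] by (simp add: H_def sum.inter_filter)
  have rs: "r + s \<in> U" "r - s \<in> U" "r + s \<noteq> 0" "r - s \<noteq> 0"
    using assms ell_facts(1) by (auto simp: vec.subspace_add vec.subspace_diff add_eq_0_iff)
  have "(\<Sum>z\<in>U. w z) + 2 * (H r + H s + H (r + s) + H (r - s)) =
      (\<Sum>z\<in>U. w z + 2 * ((if B r z = 0 then w z else 0) + (if B s z = 0 then w z else 0)
        + (if B (r + s) z = 0 then w z else 0) + (if B (r - s) z = 0 then w z else 0)))"
    by (simp add: H_def sum.distrib sum_distrib_left)
  also have "\<dots> = (\<Sum>z\<in>U. 3 * w z + 6 * (if B r z = 0 \<and> B s z = 0 then w z else 0))"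
  proof (rule sum.cong[OF refl])
    fix z
    show "w z + 2 * ((if B r z = 0 then w z else 0) + (if B s z = 0 then w z else 0)
        + (if B (r + s) z = 0 then w z else 0) + (if B (r - s) z = 0 then w z else 0)) =
      3 * w z + 6 * (if B r z = 0 \<and> B s z = 0 then w z else 0)"
      using field_cases[of "B r z"] field_cases[of "B s z"] one_neq_minus_one one_neq_minus_one[symmetric]
      unfolding B_add B_diff by (elim disjE) (simp_all add: one_plus_one)
  qed
  also have "\<dots> = 168 * k + 6 * (\<Sum>z | z \<in> U \<and> B r z = 0 \<and> B s z = 0. w z)"
    by (simp add: sum.distrib weight_total sum.inter_filter flip: sum_distrib_left)
  finally show ?thesis using assms rs H by (simp add: weight_total)
qed

end

text \<open>Double count of \<open>w s * w z\<close> over the pairs with \<open>z\<close>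
  perpendicular to both \<open>r\<close> and \<open>s\<close>. Summing over \<open>s\<close> first,
  the hyperplane sums bring in the second moment. Summing over \<open>z\<close> first,
  \<open>sum_perp_perp\<close> applies: either \<open>r\<close> and \<open>s\<close> span a line of
  the quadric, whose four weights add up to \<open>k\<close>, or \<open>r + s\<close> and
  \<open>r - s\<close> are nonsingular and weigh 0.\<close>

lemma second_moment:
  assumes ell: "ell U 729 224" and w: "weighted_ovoid U k w" and r: "r \<in> sing U"
  shows "4 * (\<Sum>z | z \<in> U \<and> B r z = 0. (w z)\<^sup>2) = (\<Sum>z\<in>U. (w z)\<^sup>2) + 12 * k\<^sup>2 - 48 * k * w r + 24 * (w r)\<^sup>2"
proof -
  define G where "G s = (\<Sum>z | z \<in> {z. z \<in> U \<and> B r z = 0} \<and> B s z = 0. w z)" for s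
  define T where "T = (\<Sum>z\<in>U. (w z)\<^sup>2)"
  define R where "R = (\<Sum>z | z \<in> U \<and> B r z = 0. (w z)\<^sup>2)"
  define a where "a = w r"
  note facts = ell_facts[OF ell w] and w_out = w_outside[OF ell w] and w_neg = w_minus[OF ell w]
  have rU: "r \<in> U" "r \<noteq> 0" "- r \<in> U" "Q r = 0" "r \<noteq> - r"
    using r facts(1) vec.subspace_neg vec_neq_minus[of r] unfolding sing_def by blast+
  have Hr: "(\<Sum>z | z \<in> U \<and> B r z = 0. w z) = 20 * k - 18 * a"
    using sum_perp[OF ell w] rU by (simp add: a_def)
  have "(\<Sum>s\<in>U. w s * G s) = (\<Sum>s\<in>U. \<Sum>z | z \<in> {z. z \<in> U \<and> B r z = 0} \<and> B s z = 0. w s * w z)"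
    by (simp add: G_def sum_distrib_left)
  also have "\<dots> = (\<Sum>z | z \<in> U \<and> B r z = 0. \<Sum>s | s \<in> U \<and> B s z = 0. w s * w z)"
    by (rule sum.swap_restrict) auto
  also have "\<dots> = (\<Sum>z | z \<in> U \<and> B r z = 0. 20 * k * w z - 18 * (w z)\<^sup>2)"
  proof (rule sum.cong[OF refl])
    fix z assume z: "z \<in> {z. z \<in> U \<and> B r z = 0}"
    have "(\<Sum>s | s \<in> U \<and> B s z = 0. w s) * w z = (20 * k - 18 * w z) * w z"
      using sum_perp[OF ell w, of z] z w_zero[OF ell w] unfolding perp_commute
      by (cases "z = 0") auto
    then show "(\<Sum>s | s \<in> U \<and> B s z = 0. w s * w z) = 20 * k * w z - 18 * (w z)\<^sup>2"
      by (simp add: sum_distrib_right power2_eq_square left_diff_distrib)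
  qed
  also have "\<dots> = 20 * k * (20 * k - 18 * a) - 18 * R"
    by (simp add: sum_subtractf Hr R_def flip: sum_distrib_left)
  finally have lhs: "(\<Sum>s\<in>U. w s * G s) = 20 * k * (20 * k - 18 * a) - 18 * R" .
  \<comment> \<open>One expression for all \<open>s\<close>: the last two terms correct the generic
    value to \<open>2 * k * w s\<close> when \<open>s\<close> is perpendicular to \<open>r\<close>,
    and the first two repair the values at \<open>r\<close> and \<open>- r\<close>, where
    \<open>sum_perp_perp\<close> does not apply.\<close>
  have "(\<Sum>s\<in>U. w s * G s) = (\<Sum>s\<in>U. (if s = r then 18 * a * k - 18 * a\<^sup>2 else 0)
      + (if s = - r then 18 * a * k - 18 * a\<^sup>2 else 0) + (8 * k - 6 * a) * w s - 6 * (w s)\<^sup>2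
      + (6 * a - 6 * k) * (if B r s = 0 then w s else 0) + 6 * (if B r s = 0 then (w s)\<^sup>2 else 0))"
    (is "_ = (\<Sum>s\<in>U. ?g s)")
  proof (rule sum.cong[OF refl])
    fix s assume s: "s \<in> U"
    have Brr: "B r r = 0" using B_self[of r] rU by simp
    consider "s \<notin> sing U" | "s = r" | "s = - r" | "s \<in> sing U" "s \<noteq> r" "s \<noteq> - r" by blast
    then show "w s * G s = ?g s"
    proof cases
      case 1
      moreover have "s \<noteq> r" "s \<noteq> - r" using 1 r s rU by (auto simp: sing_def)
      ultimately show ?thesis using w_out[OF s] by simp
    next
      case 2
      have "{z. z \<in> {z. z \<in> U \<and> B r z = 0} \<and> B r z = 0} = {z. z \<in> U \<and> B r z = 0}" by auto
      then have "G s = 20 * k - 18 * a" unfolding G_def 2 using Hr by simp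
      then have "w s * G s = a * (20 * k - 18 * a)" by (simp add: 2 a_def)
      also have "\<dots> = ?g s" using 2 rU Brr by (simp add: a_def power2_eq_square algebra_simps)
      finally show ?thesis .
    next
      case 3
      have "{z. z \<in> {z. z \<in> U \<and> B r z = 0} \<and> B (- r) z = 0} = {z. z \<in> U \<and> B r z = 0}" by auto
      then have "G s = 20 * k - 18 * a" unfolding G_def 3 using Hr by simp
      moreover have ws: "w s = a" using w_neg rU by (simp add: 3 a_def)
      ultimately have "w s * G s = a * (20 * k - 18 * a)" by simp
      also have "\<dots> = ?g s" using 3 rU Brr ws by (simp add: power2_eq_square algebra_simps)
      finally show ?thesis .
    next
      case 4
      have s0: "s \<noteq> 0" "Q s = 0" using 4 by (auto simp: sing_def)
      have "{z. z \<in> {z. z \<in> U \<and> B r z = 0} \<and> B s z = 0} = {z. z \<in> U \<and> B r z = 0 \<and> B s z = 0}" by auto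
      then have G: "G s = 8 * k - 6 * (a + w s + w (r + s) + w (r - s))"
        using sum_perp_perp[OF ell w rU(1) s rU(2) s0(1)] 4 by (simp add: G_def a_def)
      have rs: "r + s \<in> U" "r - s \<in> U" using rU s facts(1) by (simp_all add: vec.subspace_add vec.subspace_diff)
      show ?thesis
      proof (cases "B r s = 0")
        case True
        then have "a + w s + w (r + s) + w (r - s) = k"
          using w r 4 unfolding weighted_ovoid_def a_def by blast
        then have "w s * G s = w s * (2 * k)" using G by simp
        also have "\<dots> = ?g s" using True 4 by (simp add: power2_eq_square algebra_simps)
        finally show ?thesis .
      next
        case False
        then have "w (r + s) = 0" "w (r - s) = 0" using rs rU s0
          by (auto intro!: w_out simp: sing_def form_simps)
        then have "w s * G s = w s * (8 * k - 6 * (a + w s))" using G by simp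
        also have "\<dots> = ?g s" using False 4 by (simp add: power2_eq_square algebra_simps)
        finally show ?thesis .
      qed
    qed
  qed
  also have "\<dots> = 2 * (18 * a * k - 18 * a\<^sup>2) + (8 * k - 6 * a) * (56 * k) - 6 * T
      + (6 * a - 6 * k) * (20 * k - 18 * a) + 6 * R"
    using rU Hr by (simp only: sum.distrib sum_subtractf sum_distrib_left[symmetric] weight_total[OF ell w])
      (simp add: T_def R_def sum.inter_filter flip: sum.inter_filter)
  finally have "20 * k * (20 * k - 18 * a) - 18 * R = 2 * (18 * a * k - 18 * a\<^sup>2) + (8 * k - 6 * a) * (56 * k) - 6 * T
      + (6 * a - 6 * k) * (20 * k - 18 * a) + 6 * R" using lhs by simp
  then have "4 * R = T + 12 * k\<^sup>2 - 48 * k * a + 24 * a\<^sup>2"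
    by (simp add: power2_eq_square algebra_simps)
  then show ?thesis by (simp add: R_def T_def a_def)
qed

end

subsection \<open>The eight-dimensional elliptic quadric\<close>

locale elliptic_7 =
  fixes Q :: "'f::{field,finite} ^ 8 \<Rightarrow> 'f"
  assumes card_3: "CARD('f) = 3" and elliptic: "elliptic_form_7 Q"

sublocale elliptic_7 \<subseteq> ternary_form Q
  using card_3 elliptic by unfold_locales (simp_all add: elliptic_form_7_def)

context elliptic_7 begin

lemma ell_UNIV: "ell UNIV 6561 2132"
proof (rule ell_of_witt)
  have B2: "(\<forall>y. B x y = 0) \<Longrightarrow> Q x = 0" for x using B_self[of x] by simp
  show "nondeg (UNIV :: ('f ^ 8) set)"
    using elliptic B2 unfolding elliptic_form_7_def nondegenerate_def nondeg_def by blast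
  have M: "Max (vec.dim ` {U. totally_singular Q U}) = 3"
    using elliptic unfolding elliptic_form_7_def witt_index_def by simp
  have "totally_singular Q {0}" by (simp add: totally_singular_def)
  then have ne: "vec.dim ` {U. totally_singular Q U} \<noteq> {}" by blast
  have "3 \<in> vec.dim ` {U. totally_singular Q U}" using Max_in[OF _ ne] M by simp
  then obtain U where U: "totally_singular Q U" "vec.dim U = 3" by auto
  have "vec.dim U' \<le> 3" if "totally_singular Q U'" for U'
    using Max_ge[of "vec.dim ` {U. totally_singular Q U}" "vec.dim U'"] that M by simp
  then have "card U' \<noteq> 3 ^ Suc 3" if "totally_singular Q U'" for U'
    using that card_subspace[of U'] unfolding totally_singular_def
    by (metis Suc_n_not_le_n one_less_numeral_iff power_inject_exp semiring_norm(77))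
  moreover have "card U = 3 ^ 3" using U card_subspace by (simp add: totally_singular_def)
  ultimately show "witt UNIV 3" using U unfolding witt_def by blast
  show "card (UNIV :: ('f ^ 8) set) = 6561" using card_3 by simp
qed simp

lemma ell_hyp: "hyp_pair UNIV p p' \<Longrightarrow> ell (perp2 UNIV p p') 729 224"
  using ell_UNIV by (intro ell_perp2) auto

end

text \<open>\<open>h\<close> is the indicator function of the nonzero vectors spanning a point of the ovoid; as every
  point is spanned by two vectors, the sum over a plane is \<open>2 * m\<close>.\<close>

locale ovoid_function = elliptic_7 +
  fixes m :: int and h :: "'a ^ 8 \<Rightarrow> int"
  assumes h_01: "h x = 0 \<or> h x = 1"
    and h_minus [simp]: "h (- x) = h x"
    and h_sing: "h x = 1 \<Longrightarrow> x \<in> sing UNIV"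
    and h_plane: "\<lbrakk>sing_line p x; sing_line p y; B x y = 0; y \<in> sing UNIV; indep3 p x y\<rbrakk> \<Longrightarrow>
       (\<Sum>a\<in>UNIV. \<Sum>b\<in>UNIV. \<Sum>c\<in>UNIV. h (a *s p + b *s x + c *s y)) = 2 * m"
begin

section \<open>The weights of the lines through a point\<close>

lemma h_zero [simp]: "h 0 = 0"
  using h_01[of 0] h_sing[of 0] by (auto simp: sing_def)

lemma h_nonsing: "Q x \<noteq> 0 \<Longrightarrow> h x = 0"
  using h_01[of x] h_sing[of x] by (auto simp: sing_def)

lemma h_swap: "h (x - y) = h (y - x)"
  using h_minus[of "x - y"] by simp

lemma h_square: "h x * h x = h x"
  using h_01[of x] by auto

definition wt where "wt p x = h x + h (x + p) + h (x - p)"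
text \<open>\<open>wt p x\<close> counts the points of the ovoid other than \<open>p\<close> on the line spanned by \<open>p\<close> and \<open>x\<close>. For
  \<open>x = 0\<close> it is \<open>2 * h p\<close>, which \<open>wt'\<close> corrects. \<open>T p\<close> and \<open>W p r\<close> are the sums of the squared
  weights, written without the choice of a complement of \<open>p\<close>; the vectors \<open>p\<close> and \<open>- p\<close> add an
  extra \<open>4 * h p\<close>.\<close>

definition wt' where "wt' p x = (if x = 0 then 0 else wt p x)"
definition T where "T p = (\<Sum>x | B p x = 0. h x * wt p x)"
definition W where "W p r = (\<Sum>x | B p x = 0 \<and> B r x = 0. h x * wt p x)"

lemma wt_sum: "(\<Sum>a\<in>UNIV. h (z + a *s p)) = wt p z"
  by (simp add: wt_def sum_field)

lemma wt_shift: "wt p (z + a *s p) = wt p z"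
proof -
  have e: "z + p + p = z - p" "z - p - p = z + p"
    using double(1)[of p] by (simp_all only: add.assoc diff_conv_add_uminus minus_add[symmetric] minus_minus)
  have "wt p (z + p) = wt p z" "wt p (z - p) = wt p z" unfolding wt_def e by simp_all
  then show ?thesis using field_cases[of a] by auto
qed

lemma wt_minus: "wt p (- z) = wt p z"
proof -
  have "- z + p = - (z - p)" "- z - p = - (z + p)" by simp_all
  then show ?thesis unfolding wt_def by (simp only: h_minus add.commute add.left_commute)
qed

lemma wt_zero: "wt p 0 = 2 * h p"
  by (simp add: wt_def)

lemma sum_perp_wt:
  assumes "hyp_pair UNIV p p'"
  shows "(\<Sum>x | B p x = 0. h x * g x) = (\<Sum>z\<in>perp2 UNIV p p'. \<Sum>a\<in>UNIV. h (z + a *s p) * g (z + a *s p))"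
  using sum_perp_hyp[OF _ assms, of "\<lambda>x. h x * g x"] by simp

context
  fixes p p' assumes hyp: "hyp_pair UNIV p p'"
begin

abbreviation (input) "V6 \<equiv> perp2 UNIV p p'"

text \<open>The plane spanned by \<open>p\<close>, \<open>x\<close>, \<open>y\<close> is cut into
  cosets of the span of \<open>p\<close>. The coset of 0 carries \<open>2 * h p\<close> of the total
  \<open>2 * m\<close>; the other eight form four pairs of opposite cosets, one for each further
  line on \<open>p\<close>.\<close>

lemma wt'_weighted_ovoid: "weighted_ovoid V6 (m - h p) (wt' p)"
  unfolding weighted_ovoid_def
proof (intro conjI ballI impI, goal_cases)
  case (1 z)
  then show ?case by (simp add: wt'_def wt_minus)
next
  case (2 z)
  have "Q p = 0" using hyp_pairD[OF hyp] by simp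
  moreover have "B z p = 0" using 2 B_sym by (fastforce simp: perp2_def)
  ultimately show ?case using 2 h_nonsing by (auto simp: wt'_def wt_def sing_def form_simps)
next
  case (3 x y)
  note s = hyp_pairD[OF hyp]
  have V: "x \<noteq> 0" "y \<noteq> 0" "Q x = 0" "Q y = 0" "B p x = 0" "B p y = 0" "B p' x = 0" "B p' y = 0" "B x y = 0"
    "y \<noteq> x" "y \<noteq> - x"
    using 3 by (auto simp: sing_def perp2_def)
  have p0: "p \<noteq> 0" using s by auto
  have lxy: "sing_line x y" using V by (simp add: sing_line_def sing_def)
  have "x \<noteq> p" "x \<noteq> - p" "y \<noteq> p" "y \<noteq> - p" using V s by auto
  then have l: "sing_line p x" "sing_line p y" using V s p0 by (auto simp: sing_line_def sing_def)
  have ind: "indep3 p x y"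
    unfolding indep3_def
  proof (intro allI impI)
    fix a b c assume *: "a *s p + b *s x + c *s y = 0"
    then have "B p' (a *s p + b *s x + c *s y) = 0" by simp
    then have "a = 0" using V s by (simp add: form_simps)
    then show "a = 0 \<and> b = 0 \<and> c = 0" using sing_line_indep[OF lxy, of b c] * by simp
  qed
  have "2 * m = (\<Sum>a\<in>UNIV. \<Sum>b\<in>UNIV. \<Sum>c\<in>UNIV. h (a *s p + b *s x + c *s y))"
    using h_plane[OF l V(9) _ ind] V by (simp add: sing_def)
  also have "\<dots> = (\<Sum>b\<in>UNIV. \<Sum>c\<in>UNIV. \<Sum>a\<in>UNIV. h (a *s p + b *s x + c *s y))"
    by (subst sum.swap, rule sum.cong[OF refl], rule sum.swap)
  also have "\<dots> = (\<Sum>b\<in>UNIV. \<Sum>c\<in>UNIV. wt p (b *s x + c *s y))"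
    by (intro sum.cong refl) (simp add: wt_sum[symmetric] ac_simps)
  also have "\<dots> = 2 * h p + 2 * (wt p x + wt p y + wt p (x + y) + wt p (x - y))"
    using wt_minus[of p "x + y"] wt_minus[of p "x - y"]
    by (simp add: sum_field wt_minus wt_zero)
  finally show ?case
    using V by (auto simp: wt'_def add_eq_0_iff)
qed

lemma wt'_square_sum: "T p = (\<Sum>z\<in>V6. (wt' p z)\<^sup>2) + 4 * h p"
proof -
  have 0: "0 \<in> V6" by (simp add: perp2_def)
  have "T p = (\<Sum>z\<in>V6. \<Sum>a\<in>UNIV. h (z + a *s p) * wt p (z + a *s p))"
    unfolding T_def using sum_perp_wt[OF hyp] .
  also have "\<dots> = (\<Sum>z\<in>V6. (wt p z)\<^sup>2)"
    by (simp add: wt_shift wt_sum power2_eq_square flip: sum_distrib_right)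
  also have "\<dots> = (\<Sum>z\<in>V6. (wt' p z)\<^sup>2 + (if z = 0 then 4 * h p else 0))"
    by (rule sum.cong) (use h_square[of p] in \<open>auto simp: wt'_def wt_zero power2_eq_square\<close>)
  finally show ?thesis using 0 by (simp add: sum.distrib)
qed

lemma perp_sum_p: "(\<Sum>x | B p x = 0. h x) = 56 * m - 54 * h p"
proof -
  have 0: "0 \<in> V6" by (simp add: perp2_def)
  have "(\<Sum>x | B p x = 0. h x) = (\<Sum>z\<in>V6. wt p z)"
    using sum_perp_wt[OF hyp, of "\<lambda>_. 1"] by (simp add: wt_sum)
  also have "\<dots> = (\<Sum>z\<in>V6. wt' p z + (if z = 0 then 2 * h p else 0))"
    by (rule sum.cong) (auto simp: wt'_def wt_zero)
  also have "\<dots> = 56 * m - 54 * h p"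
    using 0 weight_total[OF ell_hyp[OF hyp] wt'_weighted_ovoid] by (simp add: sum.distrib)
  finally show ?thesis .
qed

text \<open>Moving \<open>r\<close> along \<open>p\<close> into the complement changes neither its
  line with \<open>p\<close>, nor the weight, nor perpendicularity to vectors perpendicular to
  \<open>p\<close>. This frees the later formulas from the choice of \<open>p'\<close>.\<close>

lemma perp_sums:
  assumes r: "sing_line p r"
  defines "r' \<equiv> r - B p' r *s p"
  shows "r' \<in> sing V6" "wt' p r' = wt p r"
    and "W p r = (\<Sum>z | z \<in> V6 \<and> B r' z = 0. (wt' p z)\<^sup>2) + 4 * h p"
    and "(\<Sum>x | B p x = 0 \<and> B r x = 0. h x) = (\<Sum>z | z \<in> V6 \<and> B r' z = 0. wt' p z) + 2 * h p"
proof -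
  note s = hyp_pairD[OF hyp]
  have R: "Q r = 0" "B p r = 0" "B r p = 0" "r \<noteq> 0" "r \<noteq> p" "r \<noteq> - p"
    using r B_sym[of r p] by (auto simp: sing_line_def sing_def)
  have "r' \<noteq> 0" using scale_cases[of "B p' r" p] R by (auto simp: r'_def)
  then show r': "r' \<in> sing V6" using R s by (auto simp: r'_def sing_def perp2_def form_simps)
  show "wt' p r' = wt p r"
    using \<open>r' \<noteq> 0\<close> wt_shift[of p r "- B p' r"] by (simp add: wt'_def r'_def)
  have perp: "B r (z + a *s p) = B r' z" if "z \<in> V6" for z a
    using that R by (simp add: r'_def form_simps perp2_def)
  have 0: "0 \<in> {z. z \<in> V6 \<and> B r' z = 0}" by (simp add: perp2_def)
  have key: "(\<Sum>x | B p x = 0 \<and> B r x = 0. h x * g x) =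
      (\<Sum>z | z \<in> V6 \<and> B r' z = 0. \<Sum>a\<in>UNIV. h (z + a *s p) * g (z + a *s p))" for g
  proof -
    have "{x. B p x = 0 \<and> B r x = 0} = {x \<in> {x. B p x = 0}. B r x = 0}" by auto
    then have "(\<Sum>x | B p x = 0 \<and> B r x = 0. h x * g x) = (\<Sum>x | B p x = 0. h x * (if B r x = 0 then g x else 0))"
      by (simp only: sum.inter_filter finite) (auto intro!: sum.cong)
    also have "\<dots> = (\<Sum>z\<in>V6. \<Sum>a\<in>UNIV. h (z + a *s p) * (if B r' z = 0 then g (z + a *s p) else 0))"
      unfolding sum_perp_wt[OF hyp] by (intro sum.cong refl) (simp add: perp)
    also have "\<dots> = (\<Sum>z\<in>V6. if B r' z = 0 then \<Sum>a\<in>UNIV. h (z + a *s p) * g (z + a *s p) else 0)"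
      by (rule sum.cong) auto
    finally show ?thesis by (simp add: sum.inter_filter)
  qed
  have "W p r = (\<Sum>z | z \<in> V6 \<and> B r' z = 0. (wt p z)\<^sup>2)"
    unfolding W_def key by (simp add: wt_shift wt_sum power2_eq_square flip: sum_distrib_right)
  also have "\<dots> = (\<Sum>z | z \<in> V6 \<and> B r' z = 0. (wt' p z)\<^sup>2 + (if z = 0 then 4 * h p else 0))"
    by (rule sum.cong) (use h_square[of p] in \<open>auto simp: wt'_def wt_zero power2_eq_square\<close>)
  finally show "W p r = (\<Sum>z | z \<in> V6 \<and> B r' z = 0. (wt' p z)\<^sup>2) + 4 * h p"
    using 0 by (simp add: sum.distrib)
  have "(\<Sum>x | B p x = 0 \<and> B r x = 0. h x) = (\<Sum>z | z \<in> V6 \<and> B r' z = 0. wt p z)"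
    using key[of "\<lambda>_. 1"] by (simp add: wt_sum)
  also have "\<dots> = (\<Sum>z | z \<in> V6 \<and> B r' z = 0. wt' p z + (if z = 0 then 2 * h p else 0))"
    by (rule sum.cong) (auto simp: wt'_def wt_zero)
  finally show "(\<Sum>x | B p x = 0 \<and> B r x = 0. h x) = (\<Sum>z | z \<in> V6 \<and> B r' z = 0. wt' p z) + 2 * h p"
    using 0 by (simp add: sum.distrib)
qed

end

section \<open>The second moment at a point, by summation along lines and planes\<close>

lemma hyp_pair_exists:
  assumes "p \<in> sing UNIV"
  obtains p' where "hyp_pair UNIV p p'"
  using hyp_partner[of UNIV p] assms ell_UNIV unfolding ell_def by blast

text \<open>This is \<open>second_moment\<close> with \<open>k = m - h p\<close>. The summand
  \<open>12 * h p\<close> is what remains of the extra \<open>4 * h p\<close> in \<open>W\<close>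
  (taken four times) and in \<open>T\<close> (taken once).\<close>

lemma W_formula:
  assumes "sing_line p r"
  shows "4 * W p r = T p + 12 * h p + 12 * (m - h p)\<^sup>2 - 48 * ((m - h p) * wt p r) + 24 * (wt p r)\<^sup>2"
proof -
  have "p \<in> sing UNIV" using assms by (simp add: sing_line_def)
  then obtain p' where hyp: "hyp_pair UNIV p p'" by (rule hyp_pair_exists)
  note ps = perp_sums[OF hyp assms]
  show ?thesis
    using second_moment[OF ell_hyp[OF hyp] wt'_weighted_ovoid[OF hyp] ps(1)]
    unfolding ps(2,3) wt'_square_sum[OF hyp] by simp
qed

lemma line_perp_sum:
  assumes "sing_line p r"
  shows "(\<Sum>x | B p x = 0 \<and> B r x = 0. h x) = 20 * m - 18 * (h p + wt p r)"
proof -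
  have "p \<in> sing UNIV" using assms by (simp add: sing_line_def)
  then obtain p' where hyp: "hyp_pair UNIV p p'" by (rule hyp_pair_exists)
  note ps = perp_sums[OF hyp assms]
  show ?thesis
    using sum_perp_sing[OF ell_hyp[OF hyp] wt'_weighted_ovoid[OF hyp] ps(1)]
    unfolding ps(2,4) by simp
qed

text \<open>\<open>W_formula\<close> at the four points of the line gives the sum of the
  \<open>T\<close> once the sum of the \<open>W\<close> is known. The latter is: for a point
  \<open>x\<close> off the line, the four lines joining it to the points of the line fill a plane,
  so their total weight depends only on \<open>m\<close>, \<open>L\<close> and
  \<open>h x\<close>.\<close>

lemma T_line_sum:
  assumes l: "sing_line p r"
  shows "T p + T r + T (p + r) + T (p - r) =
    4 * (8 * m\<^sup>2 + 60 * m) + (8 * m - 216) * (h p + h r + h (p + r) + h (p - r))"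
proof -
  define L where "L = h p + h r + h (p + r) + h (p - r)"
  define A where "A = vec.span {p, r}"
  define S where "S x = (\<Sum>q\<in>A. h (x + q))" for x
  define P where "P = {x. B p x = 0 \<and> B r x = 0}"
  note ls = sing_line_sum_diff[OF l]
  note sumA = sum_sing_line[OF l, folded A_def]
  have A: "vec.subspace A" by (simp add: A_def)
  have dr: "r + (p + r) = p - r" "r - (p - r) = - (p + r)"
    using double(1)[of r] by (simp_all add: algebra_simps)
  have wts: "wt p r = L - h p" "wt r p = L - h r" "wt (p + r) r = L - h (p + r)" "wt (p - r) r = L - h (p - r)"
    using h_swap[of p r] h_minus[of "p + r"] by (simp_all add: wt_def L_def dr add.commute)
  have Ws: "W p r = (\<Sum>x\<in>P. h x * wt p x)" "W r p = (\<Sum>x\<in>P. h x * wt r x)"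
    "W (p + r) r = (\<Sum>x\<in>P. h x * wt (p + r) x)" "W (p - r) r = (\<Sum>x\<in>P. h x * wt (p - r) x)"
    unfolding W_def P_def by (auto simp: form_simps intro!: sum.cong)
  have A_sum: "(\<Sum>q\<in>A. h q) = 2 * L"
    unfolding sumA using h_minus[of "p + r"] h_minus[of "p - r"]
    by (simp add: sum_field L_def)
  have AP: "A \<subseteq> P"
  proof
    fix x assume x: "x \<in> A"
    have "p \<in> A" "r \<in> A" by (simp_all add: A_def vec.span_base)
    then show "x \<in> P"
      using totally_singular_perp totally_singular_sing_line[OF l, folded A_def] x by (simp add: P_def)
  qed
  have pointwise: "h x * (wt p x + wt r x + wt (p + r) x + wt (p - r) x) =
      (m - L + 3) * h x + (if x \<in> A then (3 * L - m) * h x else 0)" if x: "x \<in> P" for x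
  proof (cases "h x = 0")
    case False
    then have hx: "h x = 1" using h_01 by blast
    have xs: "x \<in> sing UNIV" using h_sing hx by blast
    \<comment> \<open>The coset of \<open>x\<close> contains \<open>x\<close> once, whereas each of
      the four weights counts it; hence the excess \<open>3 * h x\<close>.\<close>
    have "wt p x + wt r x + wt (p + r) x + wt (p - r) x = 3 * h x + S x"
      unfolding S_def sumA by (simp add: sum_field wt_def algebra_simps)
    \<comment> \<open>For \<open>x\<close> outside \<open>A\<close>, the plane consists of
      \<open>A\<close> and of the cosets of \<open>x\<close> and \<open>- x\<close>, which have
      equal sums: \<open>2 * m = 2 * L + 2 * S x\<close>.\<close>
    moreover have "S x = (if x \<in> A then 2 * L else m - L)"
    proof (cases "x \<in> A")
      case True
      have "S x = (\<Sum>q\<in>A. h q)"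
        unfolding S_def
        by (rule sum.reindex_bij_witness[where i = "\<lambda>q. q - x" and j = "\<lambda>q. x + q"])
          (use A True vec.subspace_add vec.subspace_diff in auto)
      then show ?thesis using True A_sum by simp
    next
      case False
      have rA: "r \<in> A" "p \<in> A" by (simp_all add: A_def vec.span_base)
      have Bs: "B p x = 0" "B r x = 0" using x by (auto simp: P_def)
      have ne: "x \<noteq> p" "x \<noteq> - p" using False rA A vec.subspace_neg by auto
      have lx: "sing_line p x" using l xs Bs ne by (auto simp: sing_line_def)
      have ind: "indep3 p r x"
        unfolding indep3_def
      proof (intro allI impI)
        fix a b c assume *: "a *s p + b *s r + c *s x = 0"
        have "c = 0"
        proof (rule ccontr)
          assume c: "c \<noteq> 0"
          have "c *s x = - (a *s p + b *s r)" using * by (simp add: add_eq_0_iff)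
          moreover have "- (a *s p + b *s r) \<in> A"
            using rA A by (simp add: vec.subspace_add vec.subspace_scale vec.subspace_neg vec.subspace_diff)
          ultimately have "inverse c *s (c *s x) \<in> A" using A vec.subspace_scale by metis
          then show False using c False by simp
        qed
        then show "a = 0 \<and> b = 0 \<and> c = 0" using sing_line_indep[OF l, of a b] * by simp
      qed
      have "(\<Sum>q\<in>A. h (q - x)) = S x"
        unfolding S_def
        by (rule sum.reindex_bij_witness[where i = "\<lambda>q. - q" and j = "\<lambda>q. - q"])
          (use A vec.subspace_neg h_swap[of _ x] in auto)
      moreover have "(\<Sum>q\<in>A. h (q + x)) = S x" by (simp add: S_def add.commute)
      moreover have "2 * m = (\<Sum>q\<in>A. \<Sum>c\<in>UNIV. h (q + c *s x))"
        unfolding sumA using h_plane[OF l lx Bs(2) xs ind] by simp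
      ultimately have "2 * m = 2 * L + 2 * S x"
        by (simp add: sum_field sum.distrib A_sum)
      then show ?thesis using False by simp
    qed
    ultimately show ?thesis using hx by simp
  qed simp
  have "W p r + W r p + W (p + r) r + W (p - r) r =
      (\<Sum>x\<in>P. h x * (wt p x + wt r x + wt (p + r) x + wt (p - r) x))"
    unfolding Ws by (simp add: sum.distrib distrib_left)
  also have "\<dots> = (\<Sum>x\<in>P. (m - L + 3) * h x + (if x \<in> A then (3 * L - m) * h x else 0))"
    using pointwise by (rule sum.cong[OF refl])
  also have "\<dots> = (m - L + 3) * (\<Sum>x\<in>P. h x) + (3 * L - m) * (\<Sum>x\<in>A. h x)"
  proof -
    have "P \<inter> A = A" using AP by blast
    then show ?thesis by (simp add: sum.distrib sum.If_cases sum_distrib_left)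
  qed
  also have "\<dots> = (m - L + 3) * (20 * m - 18 * L) + (3 * L - m) * (2 * L)"
    using line_perp_sum[OF l] wts(1) A_sum by (simp add: P_def)
  finally have sumW: "W p r + W r p + W (p + r) r + W (p - r) r =
      (m - L + 3) * (20 * m - 18 * L) + (3 * L - m) * (2 * L)" .
  have L12: "12 * L = 12 * h p + 12 * h r + 12 * h (p + r) + 12 * h (p - r)"
    by (simp add: L_def)
  have "4 * (W p r + W r p + W (p + r) r + W (p - r) r) =
      T p + T r + T (p + r) + T (p - r) + 12 * L
      + 12 * ((m - h p)\<^sup>2 + (m - h r)\<^sup>2 + (m - h (p + r))\<^sup>2 + (m - h (p - r))\<^sup>2)
      - 48 * ((m - h p) * (L - h p) + (m - h r) * (L - h r)
        + (m - h (p + r)) * (L - h (p + r)) + (m - h (p - r)) * (L - h (p - r)))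
      + 24 * ((L - h p)\<^sup>2 + (L - h r)\<^sup>2 + (L - h (p + r))\<^sup>2 + (L - h (p - r))\<^sup>2)"
    using W_formula[OF l] W_formula[OF ls(1)] W_formula[OF ls(2)] W_formula[OF ls(3)]
      L12
    unfolding wts distrib_left by simp
  then have "T p + T r + T (p + r) + T (p - r) =
      4 * ((m - L + 3) * (20 * m - 18 * L) + (3 * L - m) * (2 * L)) - 12 * L
      - 12 * ((m - h p)\<^sup>2 + (m - h r)\<^sup>2 + (m - h (p + r))\<^sup>2 + (m - h (p - r))\<^sup>2)
      + 48 * ((m - h p) * (L - h p) + (m - h r) * (L - h r)
        + (m - h (p + r)) * (L - h (p + r)) + (m - h (p - r)) * (L - h (p - r)))
      - 24 * ((L - h p)\<^sup>2 + (L - h r)\<^sup>2 + (L - h (p + r))\<^sup>2 + (L - h (p - r))\<^sup>2)"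
    unfolding sumW by linarith
  \<comment> \<open>Since \<open>h\<close> is 0 or 1, its values and their squares both add up to
    \<open>L\<close> over the four points. The terms in \<open>L^2\<close> have coefficients 96, -48
    and -48 and cancel.\<close>
  also have "\<dots> = 4 * (8 * m\<^sup>2 + 60 * m) + (8 * m - 216) * L"
    using h_01[of p] h_01[of r] h_01[of "p + r"] h_01[of "p - r"] unfolding L_def
    by (elim disjE) (simp_all add: power2_eq_square algebra_simps)
  finally show ?thesis by (simp add: L_def)
qed

text \<open>After splitting off hyperbolic planes on \<open>p\<close> and then on \<open>x\<close>,
  20 singular vectors remain as choices of \<open>y\<close>; pairing a relation with
  \<open>p'\<close> and \<open>x'\<close> shows independence.\<close>

lemma sing_plane_exists:
  assumes p: "p \<in> sing UNIV"
  obtains x y where "x \<in> sing UNIV" "y \<in> sing UNIV" "B p x = 0" "B p y = 0" "B x y = 0" "indep3 p x y"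
proof -
  obtain p' where h1: "hyp_pair UNIV p p'" using hyp_pair_exists p by blast
  let ?V = "perp2 UNIV p p'"
  have V: "ell ?V 729 224" by (rule ell_hyp[OF h1])
  then obtain x where x: "x \<in> sing ?V" unfolding ell_def by fastforce
  then obtain x' where h2: "hyp_pair ?V x x'" using hyp_partner V unfolding ell_def by blast
  let ?V' = "perp2 ?V x x'"
  have "ell ?V' 81 20" using ell_perp2[OF _ h2, of 81 20] V by simp
  then obtain y where y: "y \<in> sing ?V'" unfolding ell_def by fastforce
  have "indep3 p x y"
    unfolding indep3_def
  proof (intro allI impI)
    fix a b c assume *: "a *s p + b *s x + c *s y = 0"
    have "B p' (a *s p + b *s x + c *s y) = 0" using * by simp
    then have a: "a = 0" using hyp_pairD[OF h1] x y by (simp add: form_simps perp2_def sing_def)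
    have "B x' (a *s p + b *s x + c *s y) = 0" using * by simp
    then have b: "b = 0" using hyp_pairD[OF h2] a y by (simp add: form_simps perp2_def sing_def)
    show "a = 0 \<and> b = 0 \<and> c = 0" using * a b y by (simp add: sing_def)
  qed
  then show ?thesis using that[of x y] x y by (auto simp: sing_def perp2_def)
qed

lemma T_value:
  assumes p: "p \<in> sing UNIV"
  shows "T p = 8 * m\<^sup>2 + 60 * m + (8 * m - 216) * h p"
proof -
  \<comment> \<open>\<open>t\<close> vanishes on all lines of a plane; comparing the lines on \<open>p\<close> with nine others kills \<open>t p\<close>.\<close>
  define t where "t x = T x - (8 * m\<^sup>2 + 60 * m) - (8 * m - 216) * h x" for x
  have line: "t x + t y + t (x + y) + t (x - y) = 0" if "sing_line x y" for x y
    using T_line_sum[OF that] by (simp add: t_def algebra_simps)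
  obtain x y where xy: "x \<in> sing UNIV" "y \<in> sing UNIV" "B p x = 0" "B p y = 0" "B x y = 0" "indep3 p x y"
    by (rule sing_plane_exists[OF p])
  have star: "(\<Sum>a\<in>UNIV. t (z + a *s p)) = - t p" if "sing_line z p" for z
    using line[OF that] by (simp add: sum_field)
  have lxy: "sing_line (x + a *s p) (y + b *s p)" for a b
    using indep3_sing_line[OF xy(6) p xy(1-5)] .
  have lx: "sing_line p x" "sing_line p y"
  proof -
    have "\<And>a b c. a *s p + b *s x + c *s y = 0 \<Longrightarrow> a = 0 \<and> b = 0 \<and> c = 0"
      using xy(6) unfolding indep3_def by blast
    from this[of 1 1 0] this[of 1 "-1" 0] this[of 1 0 1] this[of 1 0 "-1"]
    have "x \<noteq> p" "x \<noteq> - p" "y \<noteq> p" "y \<noteq> - p" by auto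
    then show "sing_line p x" "sing_line p y" using p xy by (auto simp: sing_line_def)
  qed
  have perp: "B x p = 0" "B y p = 0" using xy B_sym[of x p] B_sym[of y p] by auto
  have lines: "sing_line x p" "sing_line y p" "sing_line (x + y) p" "sing_line (x - y) p"
  proof -
    show "sing_line x p" "sing_line y p" using lx sing_line_sum_diff(1) by auto
    have ind: "1 *s x + c *s y \<noteq> a *s p" for a c
    proof
      assume "1 *s x + c *s y = a *s p"
      then have "(- a) *s p + 1 *s x + c *s y = 0" by (simp add: diff_add_eq)
      then show False using xy(6) unfolding indep3_def by (metis zero_neq_one)
    qed
    from ind[of 1 1] ind[of 1 "-1"] ind[of "-1" 1] ind[of "-1" "-1"]
    have "p \<noteq> x + y" "p \<noteq> - (x + y)" "p \<noteq> x - y" "p \<noteq> - (x - y)"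
      by fastforce+
    moreover have "x + y \<in> sing UNIV" "x - y \<in> sing UNIV"
      using sing_line_sum_diff(4,5) lxy[of 0 0] by auto
    ultimately show "sing_line (x + y) p" "sing_line (x - y) p"
      using p perp by (auto simp: sing_line_def form_simps)
  qed
  \<comment> \<open>The nine lines of the plane that miss \<open>p\<close>. Each of the twelve
    points other than \<open>p\<close> lies on three of them, and on each of the four lines through
    \<open>p\<close> the other three values add up to \<open>- t p\<close>. So the total 0 is
    \<open>-12 * t p\<close>.\<close>
  have "0 = (\<Sum>a\<in>UNIV. \<Sum>b\<in>UNIV. t (x + a *s p) + t (y + b *s p)
      + t ((x + a *s p) + (y + b *s p)) + t ((x + a *s p) - (y + b *s p)))"
    using line[OF lxy] by simp
  also have "\<dots> = (\<Sum>a\<in>UNIV. \<Sum>b\<in>(UNIV::'a set). t (x + a *s p)) + (\<Sum>a\<in>(UNIV::'a set). \<Sum>b\<in>UNIV. t (y + b *s p))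
      + (\<Sum>a\<in>UNIV. \<Sum>b\<in>UNIV. t ((x + y) + (a + b) *s p)) + (\<Sum>a\<in>UNIV. \<Sum>b\<in>UNIV. t ((x - y) + (a - b) *s p))"
    by (simp add: sum.distrib vec.scale_left_distrib vec.scale_left_diff_distrib algebra_simps)
  also have "(\<Sum>a\<in>UNIV. \<Sum>b\<in>UNIV. t ((x + y) + (a + b) *s p)) = (\<Sum>a\<in>(UNIV::'a set). \<Sum>b\<in>UNIV. t ((x + y) + b *s p))"
    by (rule sum.cong[OF refl], rule sum.reindex_bij_witness[where i = "\<lambda>b. b - a" and j = "\<lambda>b. a + b" for a]) auto
  also have "(\<Sum>a\<in>UNIV. \<Sum>b\<in>UNIV. t ((x - y) + (a - b) *s p)) = (\<Sum>a\<in>(UNIV::'a set). \<Sum>b\<in>UNIV. t ((x - y) + b *s p))"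
    by (rule sum.cong[OF refl], rule sum.reindex_bij_witness[where i = "\<lambda>b. a - b" and j = "\<lambda>b. a - b" for a]) auto
  also have "(\<Sum>a\<in>UNIV. \<Sum>b\<in>(UNIV::'a set). t (x + a *s p)) = (\<Sum>a\<in>(UNIV::'a set). \<Sum>b\<in>UNIV. t (x + b *s p))"
    by (rule sum.swap)
  finally have "t p = 0"
    unfolding star[OF lines(1)] star[OF lines(2)] star[OF lines(3)] star[OF lines(4)]
    by (simp add: card_3)
  then show ?thesis by (simp add: t_def)
qed

section \<open>Consequences of the moments at a point\<close>

context
  fixes p p' assumes hyp: "hyp_pair UNIV p p'"
begin

lemma p_sing: "p \<in> sing UNIV"
  using hyp_pairD[OF hyp] by (auto simp: sing_def)

lemma V6_facts: "vec.subspace (V6 p p')" "0 \<in> V6 p p'" "card (sing (V6 p p')) = 224" "- z \<in> V6 p p' \<longleftrightarrow> z \<in> V6 p p'"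
  using ell_hyp[OF hyp] vec.subspace_0 vec.subspace_neg[of "V6 p p'" z] vec.subspace_neg[of "V6 p p'" "- z"]
  by (auto simp: ell_def)

lemma wt'_bounds: "0 \<le> wt' p z" "wt' p z \<le> 3"
  using h_01[of z] h_01[of "z + p"] h_01[of "z - p"] by (auto simp: wt'_def wt_def)

lemma wt'_out: "z \<in> V6 p p' \<Longrightarrow> z \<notin> sing (V6 p p') \<Longrightarrow> wt' p z = 0"
  using w_outside[OF ell_hyp[OF hyp] wt'_weighted_ovoid[OF hyp]] .

lemma wt'_sum: "(\<Sum>z\<in>(V6 p p'). wt' p z) = 56 * (m - h p)"
  by (rule weight_total[OF ell_hyp[OF hyp] wt'_weighted_ovoid[OF hyp]])

lemma wt'_sum_square: "(\<Sum>z\<in>(V6 p p'). (wt' p z)\<^sup>2) = 8 * m\<^sup>2 + 60 * m + (8 * m - 220) * h p"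
  using wt'_square_sum[OF hyp] T_value[OF p_sing] by (simp add: algebra_simps)

lemma wt'_perp_sum:
  "r \<in> sing (V6 p p') \<Longrightarrow> (\<Sum>z | z \<in> V6 p p' \<and> B r z = 0. wt' p z) = 20 * (m - h p) - 18 * wt' p r"
  by (rule sum_perp_sing[OF ell_hyp[OF hyp] wt'_weighted_ovoid[OF hyp]])

lemma wt'_perp_sum_square:
  "r \<in> sing (V6 p p') \<Longrightarrow> 4 * (\<Sum>z | z \<in> V6 p p' \<and> B r z = 0. (wt' p z)\<^sup>2) =
    8 * m\<^sup>2 + 60 * m + (8 * m - 220) * h p + 12 * (m - h p)\<^sup>2 - 48 * (m - h p) * wt' p r + 24 * (wt' p r)\<^sup>2"
  using second_moment[OF ell_hyp[OF hyp] wt'_weighted_ovoid[OF hyp]] wt'_sum_square by simp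

text \<open>The vectors perpendicular to a singular \<open>r\<close> pair off as \<open>z\<close>,
  \<open>- z\<close>, each pair contributing twice an even number to the sum of
  \<open>\<phi>\<close>. In the value of this sum the terms containing the unknown weight
  \<open>a\<close> are divisible by 4, as \<open>a * (a + 3)\<close> is even.\<close>

lemma modular_equation:
  assumes "h p = 0"
  shows "4 dvd m * (m - 1)"
proof -
  obtain r where r: "r \<in> sing (V6 p p')" using V6_facts(3) by fastforce
  define a where "a = wt' p r"
  define \<phi> where "\<phi> z = (wt' p z)\<^sup>2 - wt' p z" for z
  let ?Z = "{z. z \<in> V6 p p' \<and> B r z = 0}"
  have "4 dvd (\<Sum>z\<in>?Z - {0}. \<phi> z)"
  proof (rule four_dvd_sum_even)
    fix z assume "z \<in> ?Z - {0}"
    moreover from this have "z \<noteq> - z" using vec_neq_minus by blast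
    ultimately show "- z \<in> ?Z - {0} \<and> z \<noteq> - z \<and> \<phi> (- z) = \<phi> z \<and> 2 dvd \<phi> z"
      using V6_facts(4) by (simp add: \<phi>_def wt'_def wt_minus power2_eq_square)
  qed simp
  also have "(\<Sum>z\<in>?Z - {0}. \<phi> z) = (\<Sum>z\<in>?Z. \<phi> z)"
    by (rule sum.mono_neutral_left) (auto simp: \<phi>_def wt'_def)
  also have "\<dots> = (\<Sum>z\<in>?Z. (wt' p z)\<^sup>2) - (\<Sum>z\<in>?Z. wt' p z)"
    by (simp add: \<phi>_def sum_subtractf)
  also have "\<dots> = 5 * (m * (m - 1)) - 12 * (m * a) + 6 * (a * (a + 3))"
    using wt'_perp_sum[OF r] wt'_perp_sum_square[OF r] assms
    by (simp add: a_def power2_eq_square algebra_simps)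
  finally have "4 dvd 5 * (m * (m - 1)) - 12 * (m * a) + 6 * (a * (a + 3))" .
  moreover have "even (a * (a + 3))" by simp
  moreover have "4 dvd 5 * u - 12 * v + 6 * t \<Longrightarrow> even t \<Longrightarrow> 4 dvd u" for u v t :: int
    by presburger
  ultimately show ?thesis by blast
qed

text \<open>The hyperplane sum at a singular \<open>z\<close> is 20 minus 18 times its weight and
  cannot be negative, so all weights are 0 or 1. But the first moment is 56 and the second
  68.\<close>

lemma m_neq_1:
  assumes "h p = 0"
  shows "m \<noteq> 1"
proof
  assume m: "m = 1"
  have "wt' p z = (wt' p z)\<^sup>2" if z: "z \<in> V6 p p'" for z
  proof (cases "z \<in> sing (V6 p p')")
    case True
    have "0 \<le> (\<Sum>y | y \<in> V6 p p' \<and> B z y = 0. wt' p y)" by (rule sum_nonneg) (rule wt'_bounds)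
    then have "wt' p z \<le> 1" using wt'_perp_sum[OF True] m assms by simp
    then have "wt' p z = 0 \<or> wt' p z = 1" using wt'_bounds(1)[of z] by linarith
    then show ?thesis by auto
  qed (simp add: wt'_out z)
  then have "(\<Sum>z\<in>(V6 p p'). wt' p z) = (\<Sum>z\<in>(V6 p p'). (wt' p z)\<^sup>2)" by (rule sum.cong[OF refl])
  then show False using wt'_sum wt'_sum_square m assms by simp
qed

text \<open>Mirror image of \<open>m_neq_1\<close>, as the complement of a 12-ovoid is a 1-ovoid.
  Here \<open>k = 11\<close>, and 62 singular vectors of weight at most 3 bound the hyperplane sum
  by 186, so every weight is 2 or 3. Then the second moment would be 5 * 616 - 6 * 224 = 1736, but
  it is 1748.\<close>

lemma m_neq_12:
  assumes "h p = 1"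
  shows "m \<noteq> 12"
proof
  assume m: "m = 12"
  have S: "sum g (V6 p p') = sum g (sing (V6 p p'))" if "\<And>z. z \<in> V6 p p' \<Longrightarrow> z \<notin> sing (V6 p p') \<Longrightarrow> g z = 0" for g :: "_ \<Rightarrow> int"
    by (rule sum.mono_neutral_right) (use that in \<open>auto simp: sing_def\<close>)
  have ge: "wt' p r \<ge> 2" if r: "r \<in> sing (V6 p p')" for r
  proof -
    have "(\<Sum>z | z \<in> V6 p p' \<and> B r z = 0. wt' p z) = (\<Sum>z | z \<in> sing (V6 p p') \<and> B z r = 0. wt' p z)"
      by (rule sum.mono_neutral_right) (use wt'_out B_sym[of r] in \<open>auto simp: sing_def\<close>)
    also have "\<dots> \<le> (\<Sum>z | z \<in> sing (V6 p p') \<and> B z r = 0. 3)" by (rule sum_mono) (rule wt'_bounds)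
    also have "\<dots> = 186"
      using card_sing_perp[OF ell_hyp[OF hyp] wt'_weighted_ovoid[OF hyp] r] by simp
    finally show ?thesis using wt'_perp_sum[OF r] m assms by simp
  qed
  have "(wt' p z)\<^sup>2 = 5 * wt' p z - 6" if "z \<in> sing (V6 p p')" for z
  proof -
    have "wt' p z = 2 \<or> wt' p z = 3" using ge[OF that] wt'_bounds(2)[of z] by linarith
    then show ?thesis by auto
  qed
  then have "(\<Sum>z\<in>(V6 p p'). (wt' p z)\<^sup>2) = (\<Sum>z\<in>sing (V6 p p'). 5 * wt' p z - 6)"
    using S[of "\<lambda>z. (wt' p z)\<^sup>2"] wt'_out by simp
  also have "\<dots> = 5 * (\<Sum>z\<in>(V6 p p'). wt' p z) - 1344"
    using S[of "\<lambda>z. wt' p z"] wt'_out V6_facts(3) by (simp add: sum_subtractf sum_distrib_left)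
  finally show False using wt'_sum wt'_sum_square m assms by simp
qed

text \<open>Around an \<open>r\<close> of weight 2 both moments are 24, which forces every weight
  there to equal its square, although \<open>r\<close> itself is among these vectors. Hence the
  weights are 0, 1 or 3. Over all vectors the moments differ by 180 - 168 = 12, and each vector of
  weight 3 contributes 6, so there are just two.\<close>

lemma unique_full_line_V6:
  assumes "h p = 1" "m = 4"
  obtains r where "r \<in> sing (V6 p p')" "{z \<in> V6 p p'. wt' p z = 3} = {r, - r}"
proof -
  have neq: "wt' p r \<noteq> 2" if r: "r \<in> V6 p p'" for r
  proof
    assume w: "wt' p r = 2"
    then have rs: "r \<in> sing (V6 p p')" using wt'_out r by fastforce
    then have "B r r = 0" using B_self[of r] by (simp add: sing_def)
    have ge: "(wt' p z)\<^sup>2 \<ge> wt' p z" for z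
      using wt'_bounds[of z] by (simp add: power2_eq_square mult_le_cancel_right1)
    have "(\<Sum>z | z \<in> V6 p p' \<and> B r z = 0. (wt' p z)\<^sup>2 - wt' p z) = 0"
      using wt'_perp_sum[OF rs] wt'_perp_sum_square[OF rs] assms w by (simp add: sum_subtractf)
    then have "(wt' p r)\<^sup>2 - wt' p r = 0"
      by (subst (asm) sum_nonneg_eq_0_iff) (use ge r \<open>B r r = 0\<close> in auto)
    then show False using w by simp
  qed
  let ?R = "{z \<in> V6 p p'. wt' p z = 3}"
  have "(wt' p z)\<^sup>2 - wt' p z = (if wt' p z = 3 then 6 else 0)" if "z \<in> V6 p p'" for z
  proof -
    have "wt' p z = 0 \<or> wt' p z = 1 \<or> wt' p z = 3" using neq[OF that] wt'_bounds[of z] by linarith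
    then show ?thesis by auto
  qed
  then have "(\<Sum>z\<in>(V6 p p'). (wt' p z)\<^sup>2 - wt' p z) = (\<Sum>z\<in>(V6 p p'). if wt' p z = 3 then 6 else 0)"
    by (rule sum.cong[OF refl])
  also have "\<dots> = (\<Sum>z\<in>?R. 6)" by (rule sum.inter_filter[symmetric]) simp
  finally have "6 * int (card ?R) = 12"
    using wt'_sum wt'_sum_square assms by (simp add: sum_subtractf)
  then have c: "card ?R = 2" by simp
  then have "?R \<noteq> {}" by force
  then obtain r where r: "r \<in> V6 p p'" "wt' p r = 3" by blast
  then have rs: "r \<in> sing (V6 p p')" using wt'_out[of r] by fastforce
  then have "r \<noteq> - r" using vec_neq_minus unfolding sing_def by blast
  moreover have "{r, - r} \<subseteq> ?R" using r V6_facts(4) by (auto simp: wt'_def wt_minus)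
  ultimately have "{r, - r} = ?R" using c by (intro card_subset_eq) auto
  then show ?thesis using that rs by metis
qed

end

lemma unique_full_line:
  assumes "h p = 1" "m = 4"
  obtains r where "sing_line p r" "wt p r = 3" "\<And>s. sing_line p s \<Longrightarrow> wt p s = 3 \<Longrightarrow> s \<in> vec.span {p, r}"
proof -
  obtain p' where hyp: "hyp_pair UNIV p p'" using hyp_pair_exists h_sing assms(1) by blast
  obtain r where r: "r \<in> sing (perp2 UNIV p p')" "{z \<in> perp2 UNIV p p'. wt' p z = 3} = {r, - r}"
    by (rule unique_full_line_V6[OF hyp assms])
  note s = hyp_pairD[OF hyp]
  have "wt' p r = 3" using r(2) by blast
  then have "wt p r = 3" by (simp add: wt'_def split: if_splits)
  moreover have "sing_line p r"
    using r(1) s by (auto simp: sing_line_def sing_def perp2_def)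
  moreover have "x \<in> vec.span {p, r}" if l: "sing_line p x" "wt p x = 3" for x
  proof -
    define x' where "x' = x - B p' x *s p"
    have "x' \<in> {z \<in> perp2 UNIV p p'. wt' p z = 3}"
      using perp_sums(1,2)[OF hyp l(1)] l(2) by (auto simp: x'_def sing_def)
    then have "x' = r \<or> x' = - r" unfolding r(2) by blast
    then have "x' \<in> vec.span {p, r}" by (auto intro: vec.span_base vec.span_neg)
    moreover have "B p' x *s p \<in> vec.span {p, r}" by (auto intro: vec.span_base vec.span_scale)
    moreover have "x = x' + B p' x *s p" by (simp add: x'_def)
    ultimately show ?thesis by (metis vec.span_add)
  qed
  ultimately show ?thesis using that by blast
qed

section \<open>The size of an ovoid\<close>

lemma h_outside: "x \<notin> sing UNIV \<Longrightarrow> h x = 0"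
  using h_01 h_sing by blast

text \<open>Double count of perpendicular pairs of a singular vector and a vector of the ovoid. A
  singular vector is perpendicular to 674 = 2 + 3 * 224 singular ones, so 674 + 54 = 728 times the
  sum is \<open>2132 * 56 * m\<close>. In points, the size is \<open>82 * m\<close> with 82 = 3^4 +
  1.\<close>

lemma h_total: "(\<Sum>x\<in>UNIV. h x) = 164 * m"
proof -
  have c: "int (card {p \<in> sing UNIV. B p x = 0}) = 674" if x: "x \<in> sing UNIV" for x
  proof -
    obtain x' where hyp: "hyp_pair UNIV x x'" using hyp_pair_exists x by blast
    let ?V = "perp2 UNIV x x'"
    note s = hyp_pairD[OF hyp]
    have Bx: "B z x = 0" if "z \<in> ?V" for z using that B_sym[of z x] by (simp add: perp2_def)
    have sh: "z + a *s x \<in> sing UNIV \<longleftrightarrow> z \<in> sing ?V \<or> (z = 0 \<and> a \<noteq> 0)" if z: "z \<in> ?V" for z a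
    proof (cases "z = 0")
      case True
      then show ?thesis using s by (auto simp: sing_def form_simps)
    next
      case False
      have "z + a *s x \<noteq> 0"
      proof
        assume "z + a *s x = 0"
        then have "B x' (z + a *s x) = 0" by simp
        then have "a = 0" using z s by (simp add: form_simps perp2_def)
        then show False using \<open>z + a *s x = 0\<close> False by simp
      qed
      then show ?thesis using False z s Bx by (auto simp: sing_def form_simps)
    qed
    have "{z. B x z = 0} \<inter> {z. z \<in> sing UNIV} = {p \<in> sing UNIV. B p x = 0}" using B_sym[of x] by auto
    then have "int (card {p \<in> sing UNIV. B p x = 0}) = (\<Sum>z | B x z = 0. of_bool (z \<in> sing UNIV))"
      by (simp add: sum.If_cases of_bool_def)
    also have "\<dots> = (\<Sum>z\<in>?V. \<Sum>a\<in>UNIV. of_bool (z + a *s x \<in> sing UNIV))"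
      using sum_perp_hyp[OF _ hyp, of "\<lambda>z. of_bool (z \<in> sing UNIV) :: int"] by simp
    also have "\<dots> = (\<Sum>z\<in>?V. 3 * of_bool (z \<in> sing ?V) + (if z = 0 then 2 else 0))"
    proof (rule sum.cong[OF refl])
      fix z assume z: "z \<in> ?V"
      have "(\<Sum>a\<in>UNIV. of_bool (z + a *s x \<in> sing UNIV)) =
          (\<Sum>a\<in>(UNIV::'a set). of_bool (z \<in> sing ?V \<or> z = 0 \<and> a \<noteq> 0) :: int)"
        by (simp only: sh[OF z])
      then show "(\<Sum>a\<in>UNIV. of_bool (z + a *s x \<in> sing UNIV)) =
          3 * of_bool (z \<in> sing ?V) + (if z = 0 then 2 else 0 :: int)"
        by (auto simp: sum_field sing_def)
    qed
    also have "\<dots> = 674"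
    proof -
      have "?V \<inter> {z. z \<in> sing ?V} = sing ?V" "0 \<in> ?V" by (auto simp: sing_def perp2_def)
      then show ?thesis using ell_hyp[OF hyp]
        by (simp add: sum.distrib ell_def of_bool_def sum.If_cases flip: sum_distrib_left)
    qed
    finally show ?thesis .
  qed
  have "(\<Sum>p\<in>sing UNIV. \<Sum>x | x \<in> UNIV \<and> B p x = 0. h x) = (\<Sum>x\<in>UNIV. \<Sum>p | p \<in> sing UNIV \<and> B p x = 0. h x)"
    by (rule sum.swap_restrict) auto
  also have "\<dots> = (\<Sum>x\<in>UNIV. 674 * h x)"
  proof (rule sum.cong[OF refl])
    fix x show "(\<Sum>p | p \<in> sing UNIV \<and> B p x = 0. h x) = 674 * h x"
      using c[of x] h_sing[of x] h_01[of x] by auto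
  qed
  also have "(\<Sum>p\<in>sing UNIV. \<Sum>x | x \<in> UNIV \<and> B p x = 0. h x) = (\<Sum>p\<in>sing UNIV. 56 * m - 54 * h p)"
  proof (rule sum.cong[OF refl])
    fix p assume "p \<in> sing UNIV"
    then obtain p' where "hyp_pair UNIV p p'" by (rule hyp_pair_exists)
    then show "(\<Sum>x | x \<in> UNIV \<and> B p x = 0. h x) = 56 * m - 54 * h p" using perp_sum_p by simp
  qed
  also have "\<dots> = 2132 * (56 * m) - 54 * (\<Sum>x\<in>sing UNIV. h x)"
    using ell_UNIV by (simp add: sum_subtractf ell_def flip: sum_distrib_left)
  also have "(\<Sum>x\<in>sing UNIV. h x) = (\<Sum>x\<in>UNIV. h x)"
    by (rule sum.mono_neutral_left) (auto intro: h_outside)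
  finally show ?thesis by (simp flip: sum_distrib_left)
qed

end

subsection \<open>Ovoids as sets of points\<close>

context elliptic_7 begin

lemma sum_points_on:
  assumes "S \<subseteq> quadric_points Q" "vec.subspace U"
  shows "(\<Sum>v\<in>U. of_bool (v \<noteq> 0 \<and> vec.span {v} \<in> S)) = 2 * int (card (S \<inter> points_on U))"
proof -
  have "U \<inter> {v. v \<noteq> 0 \<and> vec.span {v} \<in> S} = {v. v \<noteq> 0 \<and> vec.span {v} \<in> S \<inter> points_on U}"
    using assms(2) span_point vec.span_base by (fastforce simp: points_on_def)
  moreover have "card {v. v \<noteq> 0 \<and> vec.span {v} \<in> S \<inter> points_on U} = 2 * card (S \<inter> points_on U)"
    by (rule card_vectors_on_points) (simp add: points_on_def)
  ultimately show ?thesis by (simp add: of_bool_def sum.If_cases)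
qed

lemma m_ovoid_function:
  assumes "m_ovoid Q n S"
  shows "ovoid_function Q (int n) (\<lambda>v. of_bool (v \<noteq> 0 \<and> vec.span {v} \<in> S))"
proof
  have S: "S \<subseteq> quadric_points Q" and planes: "\<And>\<pi>. \<pi> \<in> quadric_planes Q \<Longrightarrow> card (S \<inter> points_on \<pi>) = n"
    using assms by (auto simp: m_ovoid_def)
  show "of_bool (x \<noteq> 0 \<and> vec.span {x} \<in> S) = (0::int) \<or> of_bool (x \<noteq> 0 \<and> vec.span {x} \<in> S) = (1::int)" for x
    by simp
  show "of_bool (- x \<noteq> 0 \<and> vec.span {- x} \<in> S) = (of_bool (x \<noteq> 0 \<and> vec.span {x} \<in> S) :: int)" for x
  proof (cases "x = 0")
    case False
    have "- x \<in> vec.span {x}" by (simp add: vec.span_base vec.span_neg)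
    then have "vec.span {- x} = vec.span {x}" using False by (intro span_singleton_eq) simp_all
    then show ?thesis by simp
  qed simp
  show "x \<in> sing UNIV" if "of_bool (x \<noteq> 0 \<and> vec.span {x} \<in> S) = (1::int)" for x
  proof -
    have "x \<noteq> 0" "vec.span {x} \<in> quadric_points Q" using that S by (auto split: if_splits simp: of_bool_def)
    then show ?thesis using vec.span_base[of x "{x}"] by (auto simp: sing_def quadric_points_def totally_singular_def)
  qed
  show "(\<Sum>a\<in>UNIV. \<Sum>b\<in>UNIV. \<Sum>c\<in>UNIV. of_bool (a *s p + b *s x + c *s y \<noteq> 0 \<and>
      vec.span {a *s p + b *s x + c *s y} \<in> S)) = 2 * int n"
    if "sing_line p x" "sing_line p y" "B x y = 0" "indep3 p x y" for p x y
    using sum_points_on[OF S vec.subspace_span, of "{p, x, y}"] planes[OF sing_plane_quadric[OF that]]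
    unfolding sum_sing_plane[OF that] by simp
qed

lemma ovoid_parameter:
  assumes ov: "m_ovoid Q n S" and nt: "\<not> trivial_ovoid Q S"
  shows "n \<in> {4, 5, 8, 9}"
proof -
  define h :: "'f ^ 8 \<Rightarrow> int" where "h v = of_bool (v \<noteq> 0 \<and> vec.span {v} \<in> S)" for v
  interpret ovoid_function Q "int n" h
    using m_ovoid_function[OF ov] unfolding h_def .
  have S: "S \<subseteq> quadric_points Q" using ov by (simp add: m_ovoid_def)
  have gen: "\<exists>p. p \<noteq> 0 \<and> Q p = 0 \<and> P = vec.span {p}" if "P \<in> quadric_points Q" for P
  proof -
    have P: "vec.subspace P" "vec.dim P = 1" "\<forall>x\<in>P. Q x = 0"
      using that by (auto simp: quadric_points_def totally_singular_def)
    show ?thesis using point_generator[OF P(1,2)] P(3) by metis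
  qed
  obtain P where "P \<in> S" using nt by (auto simp: trivial_ovoid_def)
  then obtain p where p: "h p = 1" using gen S by (fastforce simp: h_def)
  then obtain p' where hyp: "hyp_pair UNIV p p'" using hyp_pair_exists h_sing by blast
  obtain P' where "P' \<in> quadric_points Q - S" using nt S by (auto simp: trivial_ovoid_def)
  then obtain r where r: "h r = 0" "r \<in> sing UNIV" using gen by (fastforce simp: h_def sing_def)
  then obtain r' where hyp': "hyp_pair UNIV r r'" using hyp_pair_exists by blast
  have "n \<noteq> 1" using m_neq_1[OF hyp' r(1)] by simp
  moreover have "n \<noteq> 12" using m_neq_12[OF hyp p] by simp
  moreover have "4 dvd n * (n - 1)"
  proof (cases n)
    case (Suc k)
    then have "int (n * (n - 1)) = int n * (int n - 1)" by (simp add: algebra_simps)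
    then have "4 dvd int (n * (n - 1))" using modular_equation[OF hyp' r(1)] by metis
    then show ?thesis by (metis int_dvd_int_iff of_nat_numeral)
  qed simp
  moreover have "0 < 164 * int n"
  proof -
    have "h p \<le> (\<Sum>x\<in>UNIV. h x)" by (rule member_le_sum) (use h_01 in \<open>auto simp: h_def\<close>)
    then show ?thesis using p h_total by simp
  qed
  \<comment> \<open>A nontrivial \<open>S\<close> misses a point, so the sum of \<open>h\<close>
    stays below the number 2132 = 164 * 13 of singular vectors.\<close>
  moreover have "164 * int n < 2132"
  proof -
    have "(\<Sum>x\<in>UNIV. h x) = (\<Sum>x\<in>sing UNIV. h x)"
      by (rule sum.mono_neutral_right) (auto intro: h_outside)
    also have "\<dots> < (\<Sum>x\<in>sing UNIV. 1)"
      by (rule sum_strict_mono_ex1) (use r h_01 in \<open>auto simp: h_def intro!: bexI[of _ r]\<close>)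
    also have "\<dots> = 2132" using ell_UNIV by (simp add: ell_def)
    finally show ?thesis using h_total by simp
  qed
  ultimately have n: "n \<noteq> 1" "n \<noteq> 12" "4 dvd n * (n - 1)" "0 < n" "n < 13" by auto
  from n(1,2,4,5) have "n = 2 \<or> n = 3 \<or> n = 4 \<or> n = 5 \<or> n = 6 \<or> n = 7 \<or> n = 8 \<or> n = 9 \<or> n = 10 \<or> n = 11"
    by presburger
  then show ?thesis using n(3) by auto
qed

text \<open>The lines are all those contained in \<open>S\<close>. Exactly one passes through each
  point of \<open>S\<close>, so they partition \<open>S\<close>, and their number follows from its
  size.\<close>

lemma four_ovoid_one_system:
  assumes ov: "m_ovoid Q 4 S"
  shows "\<exists>L. one_system Q L \<and> S = (\<Union>l\<in>L. points_on l)"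
proof -
  define h :: "'f ^ 8 \<Rightarrow> int" where "h v = of_bool (v \<noteq> 0 \<and> vec.span {v} \<in> S)" for v
  interpret ovoid_function Q "int 4" h
    using m_ovoid_function[OF ov] unfolding h_def .
  have S: "S \<subseteq> quadric_points Q" using ov by (simp add: m_ovoid_def)
  define L where "L = {l \<in> quadric_lines Q. points_on l \<subseteq> S}"
  have h1: "h v = 1" if "l \<in> L" "v \<in> l" "v \<noteq> 0" for l v
    using that span_point[of v l] by (auto simp: h_def L_def quadric_lines_def totally_singular_def)
  have unique: "\<exists>l. l \<in> L \<and> P \<in> points_on l \<and> (\<forall>l'. l' \<in> L \<and> P \<in> points_on l' \<longrightarrow> l' = l)" if "P \<in> S" for P
  proof -
    have "vec.subspace P" "vec.dim P = 1" using that S by (auto simp: quadric_points_def totally_singular_def)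
    then obtain p where p: "p \<in> P" "p \<noteq> 0" "P = vec.span {p}" by (rule point_generator)
    then have hp: "h p = 1" using that by (simp add: h_def)
    obtain r where r: "sing_line p r" "wt p r = 3"
      and r_unique: "\<And>s. sing_line p s \<Longrightarrow> wt p s = 3 \<Longrightarrow> s \<in> vec.span {p, r}"
      using unique_full_line[OF hp] by auto
    let ?l = "vec.span {p, r}"
    have "card ?l = 3 ^ 2" using card_sing_line[OF r(1)] by simp
    then have "?l \<in> quadric_lines Q"
      using totally_singular_sing_line[OF r(1)] unfolding card_dim[OF vec.subspace_span]
      by (simp add: quadric_lines_def)
    have "(\<Sum>v\<in>?l. h v) = 8"
    proof -
      have "(\<Sum>v\<in>?l. h v) = (\<Sum>b\<in>UNIV. \<Sum>a\<in>UNIV. h (b *s r + a *s p))"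
        unfolding sum_sing_line[OF r(1)] by (subst sum.swap) (simp add: add.commute)
      also have "\<dots> = (\<Sum>b\<in>UNIV. wt p (b *s r))" by (simp add: wt_sum)
      \<comment> \<open>The term for 0 is \<open>wt p 0 = 2\<close>, and \<open>r\<close> and
        \<open>- r\<close> give 3 each.\<close>
      also have "\<dots> = 8" by (simp add: sum_field wt_minus wt_zero hp r(2))
      finally show ?thesis .
    qed
    then have "card (S \<inter> points_on ?l) = 4"
      using sum_points_on[OF S vec.subspace_span, of "{p, r}"] by (simp add: h_def)
    then have "S \<inter> points_on ?l = points_on ?l"
      using card_points_on_line[OF \<open>?l \<in> quadric_lines Q\<close>] by (intro card_subset_eq) auto
    then have "?l \<in> L" using \<open>?l \<in> quadric_lines Q\<close> by (auto simp: L_def)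
    moreover have "P \<in> points_on ?l"
      unfolding p(3) by (rule span_point) (use p in \<open>simp_all add: vec.span_base\<close>)
    moreover have "l = ?l" if l: "l \<in> L" "P \<in> points_on l" for l
    proof -
      have l': "totally_singular Q l" "vec.subspace l" "card l = 9"
        using l(1) card_subspace[of l] by (auto simp: L_def quadric_lines_def totally_singular_def)
      have pl: "p \<in> l" using l(2) p(1) by (auto simp: points_on_def)
      have "card {0, p, - p} < card l" using card_insert_le_m1[of 3 "{p, - p}" 0] l'(3)
        by (auto simp: card_insert_if)
      then have "\<not> l \<subseteq> {0, p, - p}" using card_mono[of "{0, p, - p}" l] by auto
      then obtain s where s: "s \<in> l" "s \<noteq> 0" "s \<noteq> p" "s \<noteq> - p" by blast
      have ls: "sing_line p s"
        using s p pl l'(1) totally_singular_perp[OF l'(1) pl s(1)]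
        by (auto simp: sing_line_def sing_def totally_singular_def)
      have "s + p \<in> l" "s - p \<in> l" using s pl l' by (simp_all add: vec.subspace_add vec.subspace_diff)
      moreover have "s + p \<noteq> 0" "s - p \<noteq> 0" using s by (auto simp: add_eq_0_iff2)
      ultimately have "wt p s = 3" using h1[OF l(1)] s by (simp add: wt_def)
      then have "vec.span {p, s} \<subseteq> ?l"
        using r_unique[OF ls] by (intro vec.span_minimal) (auto intro: vec.span_base)
      then have "vec.span {p, s} = ?l"
        using card_sing_line[OF ls] card_sing_line[OF r(1)] by (intro card_subset_eq) auto
      moreover have "vec.span {p, s} \<subseteq> l" using pl s l' by (intro vec.span_minimal) auto
      then have "vec.span {p, s} = l" using card_sing_line[OF ls] l'(3) by (intro card_subset_eq) auto
      ultimately show ?thesis by simp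
    qed
    ultimately show ?thesis by blast
  qed
  have disj: "points_on l \<inter> points_on l' = {}" if "l \<in> L" "l' \<in> L" "l \<noteq> l'" for l l'
  proof (rule equals0I)
    fix P assume "P \<in> points_on l \<inter> points_on l'"
    moreover from this have "P \<in> S" using that by (auto simp: L_def)
    ultimately show False using unique that by blast
  qed
  have SL: "S = (\<Union>l\<in>L. points_on l)"
  proof
    show "S \<subseteq> (\<Union>l\<in>L. points_on l)" using unique by blast
    show "(\<Union>l\<in>L. points_on l) \<subseteq> S" by (auto simp: L_def)
  qed
  have "card S = (\<Sum>l\<in>L. card (points_on l))"
    unfolding SL by (rule card_UN_disjoint) (use disj in auto)
  also have "\<dots> = (\<Sum>l\<in>L. 4)" by (rule sum.cong) (auto simp: L_def card_points_on_line)
  finally have "card S = 4 * card L" by simp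
  moreover have "2 * card S = 656"
  proof -
    have "S \<inter> points_on UNIV = S" using S by (auto simp: points_on_def quadric_points_def totally_singular_def)
    then have "(\<Sum>v\<in>UNIV. h v) = 2 * int (card S)"
      using sum_points_on[OF S, of UNIV] by (simp add: h_def)
    then show ?thesis using h_total by simp
  qed
  \<comment> \<open>There are 656 / 2 = 328 points, four on each line, hence 82 lines.\<close>
  ultimately have "card L = CARD('f) ^ 4 + 1" by (simp add: card_3)
  \<comment> \<open>A plane on \<open>l\<close> has only four points of \<open>S\<close>, and
    \<open>l\<close> already supplies all of them.\<close>
  moreover have "points_on \<pi> \<inter> (\<Union>l'\<in>L - {l}. points_on l') = {}"
    if l: "l \<in> L" and \<pi>: "\<pi> \<in> quadric_planes Q" "l \<subseteq> \<pi>" for l \<pi>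
  proof -
    have "card (S \<inter> points_on \<pi>) = 4" using ov \<pi> by (simp add: m_ovoid_def)
    moreover have "points_on l \<subseteq> S \<inter> points_on \<pi>" using l \<pi> by (auto simp: L_def points_on_def)
    moreover have "card (points_on l) = 4" using l by (simp add: L_def card_points_on_line)
    ultimately have "points_on l = S \<inter> points_on \<pi>" by (intro card_subset_eq) auto
    then show ?thesis using disj l SL by blast
  qed
  ultimately have "one_system Q L" using disj by (auto simp: one_system_def L_def)
  then show ?thesis using SL by blast
qed

end

theorem theorem4p3:
  fixes Q :: "'f::{field,finite} ^ 8 \<Rightarrow> 'f"
  assumes "CARD('f) = 3" and "elliptic_form_7 Q"
  shows "(\<forall>m S. m_ovoid Q m S \<and> \<not> trivial_ovoid Q S \<longrightarrow> m \<in> {4, 5, 8, 9}) \<and>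
         (\<forall>S. m_ovoid Q 4 S \<longrightarrow> (\<exists>L. one_system Q L \<and> S = (\<Union>l\<in>L. points_on l)))"
proof -
  interpret elliptic_7 Q using assms by unfold_locales
  show ?thesis using ovoid_parameter four_ovoid_one_system by blast
qed

end
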